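(* Let $A \in \mathbb{R}^{m \times n}$, $M \in \mathbb{R}^{n \times p}$ and $P \in \mathbb{R}^{n \times m}$ be given with $\operatorname{rank}(A) = k \le n \le m$ and $\operatorname{rank}(M) = n \le p$. Let $r, \ell$ be positive integers with $r + \ell \le k$, and let $\eta \ge 0$ be a real parameter, with $\eta\neq 0$ if $r < m$. Define $F = (I_n - PA)MM^{\top}A^{\top} - \eta^2 P$, assume $\operatorname{rank}(F) \ge r+\ell$, and let $\lambda_1 \ge \lambda_2 \ge \dots \ge \lambda_n$ be the eigenvalues of the symmetric matrix $H = F(AMM^{\top}A^{\top} + \eta^2 I_m)^{-1}F^{\top}$. For an integer $s$ consider the problem $$(\mathcal{P}_s)\qquad \min_{\operatorname{rank}(Z) \le s} \left\| Z \begin{bmatrix} AM & \eta I_m \end{bmatrix} - \begin{bmatrix} M - PAM & -\eta P \end{bmatrix} \right\|_{\mathrm F}^2$$ over $Z \in \mathbb{R}^{n\times m}$. Let $\widehat Z_r$ be a global minimizer of $(\mathcal{P}_r)$ and let $\widehat Z_{r+\ell}$ be a global minimizer of $(\mathcal{P}_{r+\ell})$. Then $\tilde Z_\ell = \widehat Z_{r+\ell} - \widehat Z_r$ has rank at most $\ell$ and is the global minimizer $$\tilde Z_\ell = \operatorname*{arg\,min}_{\operatorname{rank}(Z) \le \ell} \left\| \left(\widehat Z_r + Z\right) \begin{bmatrix} AM & \eta I_m \end{bmatrix} - \begin{bmatrix} M - PAM & -\eta P \end{bmatrix} \right\|_{\mathrm F}^2 .$$ Furthermore, $\tilde Z_\ell$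 is the unique global minimizer if and only if $\lambda_r > \lambda_{r+1}$ and $\lambda_{r+\ell} > \lambda_{r+\ell+1}$ (with the convention $\lambda_{n+1} := 0$ when $r+\ell = n$).
   Context: $\|\cdot\|_{\mathrm F}$ denotes the Frobenius norm, $I_n$ the $n \times n$ identity matrix, $^{\top}$ the transpose, and $[X \ \ Y]$ denotes horizontal concatenation of matrices. All matrices are real.
   Formalization: If λ_r = λ_{r+ℓ+1}, the column space of Ẑ_r is assumed to lie in that of Ẑ_{r+ℓ} (else the rank claim fails). For fixed Ẑ_r, uniqueness is equivalent to λ_{r+ℓ} > λ_{r+ℓ+1}; the two-gap criterion is proved for uniqueness over all minimizers Ẑ_r of (P_r). *)

theory Defs
  imports "HOL-Analysis.Analysis"
begin

(* A matrix with m rows and n columns has type real^'n^'m (rows are indexed by the outer type). *)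

definition hconcat :: "real^'a^'m \<Rightarrow> real^'b^'m \<Rightarrow> real^('a + 'b)^'m" where
  "hconcat X Y = (\<chi> i j. case j of Inl a \<Rightarrow> X $ i $ a | Inr b \<Rightarrow> Y $ i $ b)"

definition frobenius_norm :: "real^'a^'m \<Rightarrow> real" where
  "frobenius_norm X = sqrt (\<Sum>i\<in>UNIV. \<Sum>j\<in>UNIV. (X $ i $ j)\<^sup>2)"

definition inv_objective ::
  "real^'n^'m \<Rightarrow> real^'p^'n \<Rightarrow> real^'m^'n \<Rightarrow> real \<Rightarrow> real^'m^'n \<Rightarrow> real" where
  "inv_objective A M P \<eta> Z =
     (frobenius_norm (Z ** hconcat (A ** M) (\<eta> *\<^sub>R mat 1)
                      - hconcat (M - P ** A ** M) (- (\<eta> *\<^sub>R P))))\<^sup>2"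

(* lam 1 >= ... >= lam n lists the eigenvalues with algebraic multiplicity: the characteristic
   polynomial of H splits with these roots.  Values of lam outside {1..n} are unconstrained. *)
definition ordered_eigenvalues :: "real^'n^'n \<Rightarrow> (nat \<Rightarrow> real) \<Rightarrow> bool" where
  "ordered_eigenvalues H lam \<longleftrightarrow>
     (\<forall>i j. 1 \<le> i \<and> i \<le> j \<and> j \<le> CARD('n) \<longrightarrow> lam j \<le> lam i) \<and>
     (\<forall>x. det (mat x - H) = (\<Prod>i = 1..CARD('n). x - lam i))"

definition global_minimizer ::
  "real^'n^'m \<Rightarrow> real^'p^'n \<Rightarrow> real^'m^'n \<Rightarrow> real \<Rightarrow> nat \<Rightarrow> real^'m^'n \<Rightarrow> bool" where
  "global_minimizer A M P \<eta> s Zhat \<longleftrightarrow>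
     is_arg_min (inv_objective A M P \<eta>) (\<lambda>Z. rank Z \<le> s) Zhat"

(* For a fixed minimizer Z0 of (P_r), uniqueness of the update only detects the eigenvalue gap at
   r+l (for A = M = I_2, P = 0, r = l = 1 it is unique although lam 1 = lam 2).  The gap at r is
   detected by uniqueness over all choices of the global minimizer Z0. *)
definition update_minimizer ::
  "real^'n^'m \<Rightarrow> real^'p^'n \<Rightarrow> real^'m^'n \<Rightarrow> real \<Rightarrow> real^'m^'n \<Rightarrow> nat \<Rightarrow> real^'m^'n \<Rightarrow> bool" where
  "update_minimizer A M P \<eta> Z0 l Zt \<longleftrightarrow>
     is_arg_min (\<lambda>Z. inv_objective A M P \<eta> (Z0 + Z)) (\<lambda>Z. rank Z \<le> l) Zt"

(* Minimizers of (P_r) and (P_(r+l)) need not be compatible when one eigenvalue of H fills all the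
   positions r, ..., r+l+1: for A = M = I_3, P = 0, eta = 1 and r = l = 1 the minimizers are
   (1/2) u u^T and (1/2) (I_3 - v v^T) for arbitrary unit vectors u and v, and for u = v their
   difference has rank 3.  In that case, and only then, the column space of the first is required
   to lie in that of the second (they are built from the same eigenvectors of H). *)
definition compatible_truncations ::
  "(nat \<Rightarrow> real) \<Rightarrow> nat \<Rightarrow> nat \<Rightarrow> real^'m^'n \<Rightarrow> real^'m^'n \<Rightarrow> bool" where
  "compatible_truncations lam r l Zr Zrl \<longleftrightarrow>
     (lam r = lam (r + l + 1) \<longrightarrow> span (columns Zr) \<subseteq> span (columns Zrl))"

end

theory Submission
  imports Defs "HOL-Computational_Algebra.Polynomial" "HOL-Combinatorics.Permutations"
begin

text \<open>
  Let \<open>G = [AM  \<eta>I]\<close> and \<open>S = G G\<^sup>T\<close>, which is invertible as \<open>\<eta> \<noteq> 0\<close>. The unconstrained least-squares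
  solution is \<open>Z* = F S\<^sup>-\<^sup>1\<close>; its residual is orthogonal to the row space of \<open>G\<close>, so the objective equals
  \<open>|(Z - Z*) G|\<^sup>2\<close> up to a constant, and \<open>H = (Z* G) (Z* G)\<^sup>T\<close>. This is low-rank approximation as in
  the Eckart-Young theorem, except that \<open>Z\<close> is multiplied by \<open>G\<close>.

  If \<open>Q\<close> is the orthogonal projection onto the column space of \<open>Z\<close>, then \<open>|(Z - Z*) G|\<^sup>2 =
  |Q (Z - Z*) G|\<^sup>2 + |Z* G|\<^sup>2 - \<langle>Q, H\<rangle>\<close>. Ky Fan's maximum principle (\<open>ky_fan\<close>) bounds
  \<open>\<langle>Q, H\<rangle>\<close> by the sum of the leading \<open>s\<close> eigenvalues. Since \<open>rank F \<ge> r + l\<close> makes the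
  relevant eigenvalues positive (\<open>lam_pos\<close>), equality holds precisely for projections onto \<open>s\<close>-dimensional
  dominant eigenspaces (\<open>top_proj\<close>). So the minimisers of rank at most \<open>s\<close> are the matrices \<open>Q Z*\<close> with
  such \<open>Q\<close> (\<open>top_proj_best\<close>, \<open>best_top_proj\<close>).

  The theorem thereby becomes a statement on pairs of such projections \<open>Q\<close>, \<open>R\<close> of ranks \<open>r\<close> and
  \<open>r + l\<close>. They are nested (\<open>top_proj_nested\<close>), so \<open>R - Q\<close> is a projection of rank \<open>l\<close>, and
  the update \<open>(R - Q) Z*\<close> has rank at most \<open>l\<close>. It is optimal because every competitor leads to a
  matrix of rank at most \<open>r + l\<close>. A gap in the spectrum determines the projection; without a
  gap, an eigenvector in its range can be swapped for one in the complement with the same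
  eigenvalue, which yields another optimal matrix (\<open>top_proj_swap\<close>, \<open>low_rank_update\<close>).
\<close>

section \<open>Matrices\<close>

(* Index ranges start at 1 and should keep that form under simplification. *)
declare One_nat_def [simp del]

lemma matrix_mult_diff_right:
  fixes X :: "real^'n^'m"
  shows "X ** (Y - Z) = X ** Y - X ** Z"
  by (simp add: matrix_matrix_mult_def vec_eq_iff algebra_simps sum_subtractf)

lemma matrix_mult_diff_left:
  fixes X :: "real^'n^'m"
  shows "(X - Y) ** Z = X ** Z - Y ** Z"
  by (simp add: matrix_matrix_mult_def vec_eq_iff algebra_simps sum_subtractf)

lemma transpose_diff:
  fixes X :: "real^'n^'m"
  shows "transpose (X - Y) = transpose X - transpose Y"
  by (simp add: transpose_def vec_eq_iff)

lemma rank_add_le: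
  fixes X Y :: "real^'a^'b"
  shows "rank (X + Y) \<le> rank X + rank Y"
proof -
  let ?S = "range ((*v) X)" and ?T = "range ((*v) Y)"
  have sub: "subspace ?S" "subspace ?T" by (auto intro!: linear_subspace_image)
  have "range ((*v) (X + Y)) \<subseteq> {x + y |x y. x \<in> ?S \<and> y \<in> ?T}"
    by (auto simp: matrix_vector_mult_add_rdistrib)
  then have "rank (X + Y) \<le> dim {x + y |x y. x \<in> ?S \<and> y \<in> ?T}"
    unfolding rank_dim_range by (rule dim_subset)
  also have "\<dots> \<le> rank X + rank Y"
    using dim_sums_Int[OF sub] by (simp add: rank_dim_range)
  finally show ?thesis .
qed

section \<open>An orthonormal eigenbasis listed in the order of the eigenvalues\<close>

lemma matrix_inner_transpose:
  fixes H :: "real^'n^'m"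
  shows "(H *v x) \<bullet> y = x \<bullet> (transpose H *v y)"
  by (metis dot_lmul_matrix inner_commute transpose_matrix_vector)

lemma symmetric_matrix_inner:
  fixes H :: "real^'n^'n"
  assumes "transpose H = H"
  shows "(H *v x) \<bullet> y = x \<bullet> (H *v y)"
  using matrix_inner_transpose[of H x y] assms by simp

text \<open>A maximiser \<open>x\<close> of the Rayleigh quotient on the unit sphere of an invariant subspace is an
  eigenvector: with \<open>\<mu>\<close> the maximum, the quadratic form of \<open>\<mu> I - H\<close> is nonnegative on the
  subspace and vanishes at \<open>x\<close>, so moving from \<open>x\<close> in the direction \<open>\<mu> x - H x\<close> shows that this
  direction is zero.\<close>
lemma symmetric_matrix_eigenvector:
  fixes H :: "real^'n^'n"
  assumes sym: "transpose H = H" and V: "subspace V" "V \<noteq> {0}"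
    and inv: "\<And>x. x \<in> V \<Longrightarrow> H *v x \<in> V"
  obtains x \<mu> where "x \<in> V" "norm x = 1" "H *v x = \<mu> *\<^sub>R x"
proof -
  define K where "K = sphere 0 1 \<inter> V"
  have "compact K"
    unfolding K_def using V by (intro compact_Int_closed closed_subspace) auto
  obtain y where y: "y \<in> V" "y \<noteq> 0"
    using V subspace_0 by blast
  have "y /\<^sub>R norm y \<in> K"
    using y V by (simp add: K_def subspace_scale)
  then have "K \<noteq> {}" by blast
  have "continuous_on K (\<lambda>x. x \<bullet> (H *v x))"
    by (intro continuous_intros linear_continuous_on) simp
  then obtain x where x: "x \<in> K" and max: "\<And>y. y \<in> K \<Longrightarrow> y \<bullet> (H *v y) \<le> x \<bullet> (H *v x)"
    using continuous_attains_sup[OF \<open>compact K\<close> \<open>K \<noteq> {}\<close>] by metis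
  define \<mu> where "\<mu> = x \<bullet> (H *v x)"
  have xV: "x \<in> V" and nx: "norm x = 1" using x by (auto simp: K_def)
  have psd: "0 \<le> \<mu> * (z \<bullet> z) - z \<bullet> (H *v z)" if "z \<in> V" for z
  proof (cases "z = 0")
    case False
    have "z /\<^sub>R norm z \<in> K" using that False V by (simp add: K_def subspace_scale)
    from max[OF this] have "(z \<bullet> (H *v z)) / (norm z)\<^sup>2 \<le> \<mu>"
      by (simp add: \<mu>_def matrix_vector_mult_scaleR power2_eq_square divide_simps)
    then show ?thesis using False by (simp add: divide_simps power2_norm_eq_inner)
  qed simp
  define w where "w = \<mu> *\<^sub>R x - H *v x"
  have wV: "w \<in> V" unfolding w_def using V xV inv by (simp add: subspace_diff subspace_scale)
  define q where "q = \<mu> * (w \<bullet> w) - w \<bullet> (H *v w)"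
  have q0: "q \<ge> 0" unfolding q_def by (rule psd[OF wV])
  have line: "0 \<le> 2 * t * (w \<bullet> w) + t\<^sup>2 * q" for t
  proof -
    have xx: "x \<bullet> x = 1" using nx by (simp add: norm_eq_1)
    have sw: "x \<bullet> (H *v w) = w \<bullet> (H *v x)"
      using symmetric_matrix_inner[OF sym, of x w] by (simp add: inner_commute)
    have "w \<bullet> w = \<mu> * (x \<bullet> w) - w \<bullet> (H *v x)"
      by (subst (2) w_def) (simp add: inner_diff_right inner_commute[of w x])
    moreover have "\<mu> * ((x + t *\<^sub>R w) \<bullet> (x + t *\<^sub>R w)) - (x + t *\<^sub>R w) \<bullet> (H *v (x + t *\<^sub>R w))
      = 2 * t * (\<mu> * (x \<bullet> w) - w \<bullet> (H *v x)) + t\<^sup>2 * q"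
      unfolding q_def using xx sw \<mu>_def
      by (simp add: matrix_vector_right_distrib matrix_vector_mult_scaleR inner_add_left
          inner_add_right inner_commute[of w x] algebra_simps power2_eq_square)
    ultimately show ?thesis
      using psd[of "x + t *\<^sub>R w"] xV wV V by (simp add: subspace_add subspace_scale)
  qed
  have "w \<bullet> w = 0"
  proof (rule ccontr)
    assume "w \<bullet> w \<noteq> 0"
    then have pos: "w \<bullet> w > 0" by simp
    define t where "t = - (w \<bullet> w) / (q + 1)"
    have "t < 0" using pos q0 by (simp add: t_def divide_simps)
    have "2 * (w \<bullet> w) + t * q > 0"
    proof -
      have "t * q \<ge> - (w \<bullet> w)"
        using pos q0 by (simp add: t_def divide_simps mult_left_mono algebra_simps)
      then show ?thesis using pos by linarith
    qed
    then have "t * (2 * (w \<bullet> w) + t * q) < 0"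
      using \<open>t < 0\<close> by (simp add: mult_neg_pos)
    then show False using line[of t] by (simp add: algebra_simps power2_eq_square)
  qed
  then have "H *v x = \<mu> *\<^sub>R x" by (simp add: w_def)
  with that xV nx show ?thesis by blast
qed

text \<open>The spectral theorem by induction on the dimension: the orthogonal complement of an eigenvector
  inside an invariant subspace is again invariant.\<close>
lemma symmetric_matrix_eigenbasis_subspace:
  fixes H :: "real^'n^'n"
  assumes sym: "transpose H = H" and "subspace V" and "\<And>x. x \<in> V \<Longrightarrow> H *v x \<in> V"
  shows "\<exists>B. B \<subseteq> V \<and> pairwise orthogonal B \<and> (\<forall>b\<in>B. norm b = 1) \<and> finite B \<and> card B = dim V \<and>
    (\<forall>b\<in>B. \<exists>\<mu>. H *v b = \<mu> *\<^sub>R b)"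
  using assms(2,3)
proof (induction "dim V" arbitrary: V)
  case 0
  then show ?case by (intro exI[of _ "{}"]) (auto simp: pairwise_def)
next
  case (Suc d)
  have "V \<noteq> {0}" using Suc.hyps(2) by auto
  obtain x \<mu> where x: "x \<in> V" "norm x = 1" "H *v x = \<mu> *\<^sub>R x"
    using symmetric_matrix_eigenvector[OF sym Suc.prems(1) \<open>V \<noteq> {0}\<close> Suc.prems(2)] by metis
  define W where "W = {y \<in> V. orthogonal x y}"
  have "dim {y \<in> V. \<forall>z \<in> span {x}. orthogonal z y} + dim (span {x}) = dim V"
    using Suc.prems(1) x(1) by (intro dim_subspace_orthogonal_to_vectors)
      (auto simp: span_minimal)
  moreover have "{y \<in> V. \<forall>z \<in> span {x}. orthogonal z y} = W"
    by (auto simp: W_def span_singleton orthogonal_def span_base)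
  moreover have "dim (span {x}) = 1" using x(2) by (auto simp: dim_span)
  ultimately have dW: "dim W = d" using Suc.hyps(2) by simp
  have sW: "subspace W"
    using Suc.prems(1) unfolding W_def subspace_def
    by (auto simp: orthogonal_def inner_right_distrib)
  have iW: "H *v y \<in> W" if "y \<in> W" for y
    using that Suc.prems(2) x(3) symmetric_matrix_inner[OF sym, of x y]
    by (auto simp: W_def orthogonal_def)
  obtain B where B: "B \<subseteq> W" "pairwise orthogonal B" "\<forall>b\<in>B. norm b = 1" "finite B" "card B = d"
    "\<forall>b\<in>B. \<exists>\<mu>. H *v b = \<mu> *\<^sub>R b"
    using Suc.hyps(1)[OF dW[symmetric] sW iW] dW by auto
  have "x \<notin> B" using B(1) x(2) by (auto simp: W_def orthogonal_def)
  show ?case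
  proof (intro exI[of _ "insert x B"] conjI)
    show "pairwise orthogonal (insert x B)"
      using B(1,2) by (auto simp: pairwise_insert W_def orthogonal_commute)
    show "card (insert x B) = dim V" using B \<open>x \<notin> B\<close> Suc.hyps(2) by simp
  qed (use B x in \<open>auto simp: W_def\<close>)
qed

text \<open>Both products are values of polynomials, which agree as polynomials because they agree on an
  infinite field; the multiset of roots of a polynomial is determined by it.\<close>
lemma prod_linear_factors_unique:
  fixes f :: "'a \<Rightarrow> real" and g :: "'b \<Rightarrow> real"
  assumes "finite A" "finite B" and eq: "\<And>x. (\<Prod>i\<in>A. x - f i) = (\<Prod>j\<in>B. x - g j)"
  shows "image_mset f (mset_set A) = image_mset g (mset_set B)"
proof -
  have roots: "proots (\<Prod>i\<in>C. [:- h i, 1:]) = image_mset h (mset_set C)"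
    if "finite C" for C :: "'c set" and h :: "'c \<Rightarrow> real"
    using that by (subst proots_prod) (auto simp: sum_unfold_sum_mset image_mset.compositionality o_def)
  have "(\<Prod>i\<in>A. [:- f i, 1:]) = (\<Prod>j\<in>B. [:- g j, 1:])"
    by (subst poly_eq_poly_eq_iff[symmetric]) (auto simp: fun_eq_iff poly_prod eq)
  then show ?thesis using roots[of A f] roots[of B g] assms by simp
qed

locale ordered_eigenbasis =
  fixes H :: "real^'n^'n" and lam :: "nat \<Rightarrow> real" and e :: "nat \<Rightarrow> real^'n"
  assumes orthonormal: "\<lbrakk>i \<in> {1..CARD('n)}; j \<in> {1..CARD('n)}\<rbrakk> \<Longrightarrow> e i \<bullet> e j = (if i = j then 1 else 0)"
    and eigen: "i \<in> {1..CARD('n)} \<Longrightarrow> H *v e i = lam i *\<^sub>R e i"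
    and decreasing: "\<lbrakk>1 \<le> i; i \<le> j; j \<le> CARD('n)\<rbrakk> \<Longrightarrow> lam j \<le> lam i"

text \<open>Any orthonormal eigenbasis diagonalises \<open>H\<close>, so its eigenvalues are, with multiplicity, the
  roots of the characteristic polynomial; a permutation matches them with the given list.\<close>
lemma ordered_eigenbasis_exists:
  fixes H :: "real^'n^'n"
  assumes sym: "transpose H = H" and ord: "ordered_eigenvalues H lam"
  obtains e where "ordered_eigenbasis H lam e"
proof -
  obtain B :: "(real^'n) set" where B: "pairwise orthogonal B" "\<forall>b\<in>B. norm b = 1" "finite B"
    "card B = CARD('n)" "\<forall>b\<in>B. \<exists>\<mu>. H *v b = \<mu> *\<^sub>R b"
    using symmetric_matrix_eigenbasis_subspace[OF sym, of UNIV] by auto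
  obtain f :: "'n \<Rightarrow> real^'n" where f: "bij_betw f UNIV B"
    using finite_same_card_bij[of "UNIV :: 'n set" B] B(3,4) by auto
  have "\<forall>i. \<exists>\<mu>. H *v f i = \<mu> *\<^sub>R f i"
    using B(5) f by (auto simp: bij_betw_def)
  then obtain d where d: "\<And>i. H *v f i = d i *\<^sub>R f i" by metis
  have on: "f i \<bullet> f j = (if i = j then 1 else 0)" for i j
  proof (cases "i = j")
    case True
    have "f i \<in> B" using f by (auto simp: bij_betw_def)
    then show ?thesis using B(2) True by (simp add: norm_eq_1)
  next
    case False
    have "f i \<in> B" "f j \<in> B" "f i \<noteq> f j" using f False by (auto simp: bij_betw_def inj_on_def)
    then show ?thesis using B(1) False by (auto simp: pairwise_def orthogonal_def)
  qed
  define E :: "real^'n^'n" where "E = (\<chi> a i. f i $ a)"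
  have col: "column i E = f i" for i by (simp add: E_def column_def vec_eq_iff)
  have orthE: "orthogonal_matrix E"
    unfolding orthogonal_matrix_orthonormal_columns by (simp add: col on norm_eq_1 orthogonal_def)
  have charpoly: "det (mat x - H) = (\<Prod>i\<in>UNIV. x - d i)" for x
  proof -
    define D where "D = transpose E ** ((mat x - H) ** E)"
    have D: "D $ i $ j = (if i = j then x - d i else 0)" for i j
    proof -
      have cHE: "column j ((mat x - H) ** E) = (x - d j) *\<^sub>R f j"
      proof -
        have "column j ((mat x - H) ** E) = (mat x - H) *v column j E"
          by (simp add: column_def vec_eq_iff matrix_matrix_mult_def matrix_vector_mult_def)
        also have "\<dots> = x *\<^sub>R f j - d j *\<^sub>R f j"
        proof -
          have "mat x *v f j = x *\<^sub>R f j"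
            by (simp add: vec_eq_iff matrix_vector_mult_def mat_def if_distrib if_distribR cong: if_cong)
          then show ?thesis by (simp add: col matrix_vector_mult_diff_rdistrib d)
        qed
        finally show ?thesis by (simp add: scaleR_diff_left)
      qed
      have "D $ i $ j = column i E \<bullet> column j ((mat x - H) ** E)"
        by (simp add: D_def matrix_matrix_mult_def transpose_def column_def inner_vec_def)
      then show ?thesis by (simp add: cHE col on)
    qed
    have "det D = (\<Prod>i\<in>UNIV. D $ i $ i)" by (rule det_diagonal) (simp add: D)
    moreover have "det D = det (mat x - H) * det (transpose E ** E)"
      by (simp add: D_def det_mul)
    ultimately show ?thesis
      using orthE D by (simp add: orthogonal_matrix)
  qed
  obtain h :: "nat \<Rightarrow> 'n" where h: "bij_betw h {1..CARD('n)} UNIV"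
    using finite_same_card_bij[of "{1..CARD('n)}" "UNIV :: 'n set"] by auto
  have "(\<Prod>i\<in>{1..CARD('n)}. x - lam i) = (\<Prod>i\<in>{1..CARD('n)}. x - d (h i))" for x
    using ord charpoly prod.reindex_bij_betw[OF h, of "\<lambda>i. x - d i"]
    by (simp add: ordered_eigenvalues_def)
  then have "image_mset lam (mset_set {1..CARD('n)}) = image_mset (d \<circ> h) (mset_set {1..CARD('n)})"
    by (intro prod_linear_factors_unique) auto
  then obtain p where p: "p permutes {1..CARD('n)}" "\<forall>i\<in>{1..CARD('n)}. lam i = (d \<circ> h) (p i)"
    using image_mset_eq_implies_permutes[OF finite_atLeastAtMost] by blast
  have inj: "inj_on (h \<circ> p) {1..CARD('n)}"
    using bij_betw_trans[OF permutes_imp_bij[OF p(1)] h] by (rule bij_betw_imp_inj_on)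
  have "ordered_eigenbasis H lam (f \<circ> h \<circ> p)"
  proof
    show "(f \<circ> h \<circ> p) i \<bullet> (f \<circ> h \<circ> p) j = (if i = j then 1 else 0)"
      if "i \<in> {1..CARD('n)}" "j \<in> {1..CARD('n)}" for i j
      using inj_on_eq_iff[OF inj that] by (simp add: on)
    show "H *v (f \<circ> h \<circ> p) i = lam i *\<^sub>R (f \<circ> h \<circ> p) i" if "i \<in> {1..CARD('n)}" for i
      using that p(2) d by simp
    show "lam j \<le> lam i" if "1 \<le> i" "i \<le> j" "j \<le> CARD('n)" for i j
      using ord that by (auto simp: ordered_eigenvalues_def)
  qed
  with that show ?thesis by blast
qed

section \<open>Orthogonal projections\<close>

definition orth_proj :: "real^'n^'n \<Rightarrow> bool" where
  "orth_proj Q \<longleftrightarrow> transpose Q = Q \<and> Q ** Q = Q"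

lemma orth_proj_mult: "orth_proj Q \<Longrightarrow> Q *v (Q *v x) = Q *v x"
  by (simp add: orth_proj_def matrix_vector_mul_assoc)

lemma orth_proj_inner: "orth_proj Q \<Longrightarrow> (Q *v x) \<bullet> y = x \<bullet> (Q *v y)"
  by (simp add: orth_proj_def symmetric_matrix_inner)

lemma orth_proj_norm: "orth_proj Q \<Longrightarrow> (Q *v x) \<bullet> (Q *v x) = x \<bullet> (Q *v x)"
  by (simp add: orth_proj_inner orth_proj_mult)

lemma orth_proj_pythagoras:
  assumes "orth_proj Q"
  shows "x \<bullet> x = (Q *v x) \<bullet> (Q *v x) + (x - Q *v x) \<bullet> (x - Q *v x)"
  using orth_proj_norm[OF assms, of x] by (simp add: inner_diff_left inner_diff_right inner_commute)

lemma orth_proj_le: "orth_proj Q \<Longrightarrow> (Q *v x) \<bullet> (Q *v x) \<le> x \<bullet> x"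
  using orth_proj_pythagoras[of Q x] by simp

lemma orth_proj_fixed:
  assumes "orth_proj Q" "(Q *v x) \<bullet> (Q *v x) = x \<bullet> x"
  shows "Q *v x = x"
  using orth_proj_pythagoras[OF assms(1), of x] assms(2) by simp

lemma orth_proj_range: "orth_proj Q \<Longrightarrow> x \<in> range ((*v) Q) \<longleftrightarrow> Q *v x = x"
  by (metis orth_proj_mult rangeE rangeI)

lemma orth_proj_diff:
  assumes "orth_proj Q" "orth_proj R" "Q ** R = R"
  shows "orth_proj (Q - R)"
proof -
  have "R ** Q = R"
    using assms by (metis matrix_transpose_mul orth_proj_def)
  then show ?thesis
    using assms by (simp add: orth_proj_def transpose_diff matrix_mult_diff_right matrix_mult_diff_left)
qed

text \<open>The orthogonal projection onto the span of \<open>B\<close> when \<open>B\<close> is orthonormal.\<close>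
definition span_proj :: "(real^'n) set \<Rightarrow> real^'n^'n" where
  "span_proj B = (\<chi> i j. \<Sum>b\<in>B. b $ i * b $ j)"

lemma span_proj_mult: "span_proj B *v x = (\<Sum>b\<in>B. (b \<bullet> x) *\<^sub>R b)"
proof -
  have "(\<Sum>j\<in>UNIV. (\<Sum>b\<in>B. b $ i * b $ j) * x $ j) = (\<Sum>b\<in>B. (\<Sum>j\<in>UNIV. b $ j * x $ j) * b $ i)" for i
    by (simp add: sum_distrib_left sum_distrib_right sum.swap[of _ B] algebra_simps)
  then show ?thesis
    by (simp add: vec_eq_iff span_proj_def matrix_vector_mult_def inner_vec_def)
qed

lemma transpose_span_proj: "transpose (span_proj B) = span_proj B"
  by (simp add: span_proj_def transpose_def vec_eq_iff mult.commute)

lemma span_proj_fixes: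
  assumes "pairwise orthogonal B" "\<And>b. b \<in> B \<Longrightarrow> norm b = 1" "finite B" "x \<in> span B"
  shows "span_proj B *v x = x"
  using orthonormal_basis_expand[OF assms(1,2,4,3)] by (simp add: span_proj_mult inner_commute)

lemma span_proj_in_span: "span_proj B *v x \<in> span B"
  by (simp add: span_proj_mult span_sum span_scale span_base)

lemma orth_proj_span_proj:
  assumes "pairwise orthogonal B" "\<And>b. b \<in> B \<Longrightarrow> norm b = 1" "finite B"
  shows "orth_proj (span_proj B)" and "range ((*v) (span_proj B)) = span B"
proof -
  note fixes_span = span_proj_fixes[OF assms]
  show "orth_proj (span_proj B)"
    by (simp add: orth_proj_def transpose_span_proj matrix_eq fixes_span span_proj_in_span
        flip: matrix_vector_mul_assoc)
  show "range ((*v) (span_proj B)) = span B"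
    using fixes_span span_proj_in_span by (metis (no_types, lifting) rangeE rangeI subsetI subset_antisym)
qed

lemma orth_proj_onto_subspace:
  fixes V :: "(real^'n) set"
  assumes "subspace V"
  obtains Q where "orth_proj Q" "range ((*v) Q) = V"
proof -
  obtain B where "pairwise orthogonal B" "\<And>x. x \<in> B \<Longrightarrow> norm x = 1" "independent B" "span B = V"
    using orthonormal_basis_subspace[OF assms] by metis
  with that orth_proj_span_proj show ?thesis
    by (metis independent_imp_finite)
qed

lemma mult_outer_swap:
  "(X - span_proj {u} + span_proj {v}) *v x = X *v x - (u \<bullet> x) *\<^sub>R u + (v \<bullet> x) *\<^sub>R v"
  by (simp add: matrix_vector_mult_add_rdistrib matrix_vector_mult_diff_rdistrib span_proj_mult)

lemma orth_proj_swap: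
  assumes Q: "orth_proj Q" and u: "norm u = 1" "Q *v u = u" and v: "norm v = 1" "Q *v v = 0"
  shows "orth_proj (Q - span_proj {u} + span_proj {v})"
proof -
  have uv: "u \<bullet> v = 0" "v \<bullet> u = 0"
    using orth_proj_inner[OF Q, of u v] u v by (auto simp: inner_commute)
  have uu: "u \<bullet> u = 1" "v \<bullet> v = 1" using u v by (auto simp: norm_eq_1)
  have uQ: "u \<bullet> (Q *v x) = u \<bullet> x" "v \<bullet> (Q *v x) = 0" for x
    using orth_proj_inner[OF Q, of u x] orth_proj_inner[OF Q, of v x] u v by auto
  have "transpose (Q - span_proj {u} + span_proj {v}) = Q - span_proj {u} + span_proj {v}"
    using Q transpose_span_proj[of "{u}"] transpose_span_proj[of "{v}"]
    by (simp add: orth_proj_def transpose_def vec_eq_iff)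
  then show ?thesis
    by (simp add: orth_proj_def matrix_eq mult_outer_swap orth_proj_mult[OF Q] u v uv uu uQ
        matrix_vector_mult_scaleR matrix_vector_right_distrib matrix_vector_mult_diff_distrib
        inner_add_right inner_diff_right flip: matrix_vector_mul_assoc)
qed

lemma matrix_inner_component:
  fixes X Y :: "real^'n^'m"
  shows "X \<bullet> Y = (\<Sum>i\<in>UNIV. \<Sum>j\<in>UNIV. X $ i $ j * Y $ i $ j)"
  by (simp add: inner_vec_def)

lemma matrix_inner_mult_left:
  fixes X :: "real^'n^'m" and Y :: "real^'k^'n" and Z :: "real^'k^'m"
  shows "(X ** Y) \<bullet> Z = Y \<bullet> (transpose X ** Z)"
proof -
  have "(X ** Y) \<bullet> Z = (\<Sum>i\<in>UNIV. \<Sum>j\<in>UNIV. \<Sum>k\<in>UNIV. X $ i $ k * Y $ k $ j * Z $ i $ j)"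
    by (simp add: matrix_inner_component matrix_matrix_mult_def sum_distrib_right)
  also have "\<dots> = (\<Sum>k\<in>UNIV. \<Sum>j\<in>UNIV. \<Sum>i\<in>UNIV. X $ i $ k * Y $ k $ j * Z $ i $ j)"
    by (subst sum.swap, subst (2) sum.swap, subst sum.swap) simp
  also have "\<dots> = Y \<bullet> (transpose X ** Z)"
    by (simp add: matrix_inner_component matrix_matrix_mult_def transpose_def sum_distrib_left
        algebra_simps)
  finally show ?thesis .
qed

lemma matrix_inner_mult_right:
  fixes X :: "real^'n^'m" and Y :: "real^'k^'n" and Z :: "real^'k^'m"
  shows "(X ** Y) \<bullet> Z = X \<bullet> (Z ** transpose Y)"
  by (simp add: inner_vec_def matrix_matrix_mult_def transpose_def sum_distrib_left sum_distrib_right,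
      intro sum.cong refl, subst sum.swap, simp add: algebra_simps)

lemma orth_proj_matrix_norm:
  fixes X :: "real^'k^'n"
  assumes "orth_proj Q"
  shows "(norm (Q ** X))\<^sup>2 = (Q ** X) \<bullet> X"
  using assms matrix_inner_mult_left[of Q X "Q ** X"] matrix_inner_mult_left[of Q X X]
  by (simp add: power2_norm_eq_inner orth_proj_def matrix_mul_assoc)

lemma orth_proj_matrix_pythagoras:
  fixes X :: "real^'k^'n"
  assumes "orth_proj Q"
  shows "(norm X)\<^sup>2 = (norm (Q ** X))\<^sup>2 + (norm (X - Q ** X))\<^sup>2"
  using orth_proj_matrix_norm[OF assms, of X]
  by (simp add: power2_norm_eq_inner inner_diff_left inner_diff_right inner_commute)

context ordered_eigenbasis
begin

lemma basis_expand: "(\<Sum>i\<in>{1..CARD('n)}. (x \<bullet> e i) *\<^sub>R e i) = x"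
  and basis_inj: "inj_on e {1..CARD('n)}"
  and basis_orthogonal: "pairwise orthogonal (e ` {1..CARD('n)})"
proof -
  have nz: "norm (e i) = 1" if "i \<in> {1..CARD('n)}" for i
    using orthonormal[OF that that] by (simp add: norm_eq_1)
  show inj: "inj_on e {1..CARD('n)}"
    using orthonormal by (metis inj_onI zero_neq_one)
  show orth: "pairwise orthogonal (e ` {1..CARD('n)})"
    using orthonormal by (auto simp: pairwise_def orthogonal_def)
  have "independent (e ` {1..CARD('n)})"
    using orth nz by (intro pairwise_orthogonal_independent) force+
  then have "dim (e ` {1..CARD('n)}) = DIM(real^'n)"
    by (simp add: dim_eq_card_independent card_image inj)
  then have sp: "span (e ` {1..CARD('n)}) = UNIV" by (rule dim_eq_full[THEN iffD1])
  have "(\<Sum>b\<in>e ` {1..CARD('n)}. (x \<bullet> b) *\<^sub>R b) = x"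
    using orth nz sp by (intro orthonormal_basis_expand) auto
  then show "(\<Sum>i\<in>{1..CARD('n)}. (x \<bullet> e i) *\<^sub>R e i) = x"
    by (simp add: sum.reindex[OF inj])
qed

lemma parseval: "(\<Sum>i\<in>{1..CARD('n)}. (x \<bullet> e i) * (y \<bullet> e i)) = x \<bullet> y"
proof -
  have "x \<bullet> y = (\<Sum>i\<in>{1..CARD('n)}. (x \<bullet> e i) *\<^sub>R e i) \<bullet> y"
    by (simp only: basis_expand)
  also have "\<dots> = (\<Sum>i\<in>{1..CARD('n)}. (x \<bullet> e i) * (y \<bullet> e i))"
    unfolding inner_sum_left by (simp add: inner_commute)
  finally show ?thesis by simp
qed

lemma matrix_eq_on_basis:
  fixes X Y :: "real^'n^'m"
  assumes "\<And>i. i \<in> {1..CARD('n)} \<Longrightarrow> X *v e i = Y *v e i"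
  shows "X = Y"
proof -
  have "X *v x = Y *v x" for x
  proof -
    have "X *v x = X *v (\<Sum>i\<in>{1..CARD('n)}. (x \<bullet> e i) *\<^sub>R e i)" by (simp only: basis_expand)
    also have "\<dots> = Y *v (\<Sum>i\<in>{1..CARD('n)}. (x \<bullet> e i) *\<^sub>R e i)"
      using assms by (simp add: linear_sum[OF matrix_vector_mul_linear] matrix_vector_mult_scaleR)
    finally show ?thesis by (simp only: basis_expand)
  qed
  then show ?thesis by (simp add: matrix_eq)
qed

lemma matrix_inner_basis:
  fixes X Y :: "real^'n^'m"
  shows "X \<bullet> Y = (\<Sum>i\<in>{1..CARD('n)}. (X *v e i) \<bullet> (Y *v e i))"
proof -
  have "X \<bullet> Y = (\<Sum>r\<in>UNIV. \<Sum>i\<in>{1..CARD('n)}. (X $ r \<bullet> e i) * (Y $ r \<bullet> e i))"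
    by (simp add: inner_vec_def[of X] parseval)
  also have "\<dots> = (\<Sum>i\<in>{1..CARD('n)}. (X *v e i) \<bullet> (Y *v e i))"
    by (subst sum.swap) (simp add: inner_vec_def[of "_ *v _"] matrix_vector_mul_component)
  finally show ?thesis .
qed

text \<open>For an orthonormal basis \<open>B\<close> of the range, both sides are the double sum of the squares of
  \<open>b \<bullet> e i\<close>, which Parseval evaluates to the cardinality of \<open>B\<close>.\<close>
lemma rank_orth_proj:
  assumes "orth_proj Q"
  shows "real (rank Q) = (\<Sum>i\<in>{1..CARD('n)}. (Q *v e i) \<bullet> (Q *v e i))"
proof -
  have "subspace (range ((*v) Q))" by (simp add: linear_subspace_image)
  then obtain B where B: "pairwise orthogonal B" "\<And>x. x \<in> B \<Longrightarrow> norm x = 1" "independent B"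
    "span B = range ((*v) Q)" "card B = dim (range ((*v) Q))"
    using orthonormal_basis_subspace by metis
  have fin: "finite B" using B(3) independent_imp_finite by blast
  have expand: "(Q *v e i) \<bullet> (Q *v e i) = (\<Sum>b\<in>B. (b \<bullet> e i) * (b \<bullet> e i))" for i
  proof -
    have "Q *v e i = (\<Sum>b\<in>B. ((Q *v e i) \<bullet> b) *\<^sub>R b)"
      using orthonormal_basis_expand[OF B(1,2) _ fin] B(4) by simp
    then have "(Q *v e i) \<bullet> (Q *v e i) = (\<Sum>b\<in>B. ((Q *v e i) \<bullet> b) *\<^sub>R b) \<bullet> (Q *v e i)"
      by simp
    also have "\<dots> = (\<Sum>b\<in>B. ((Q *v e i) \<bullet> b) * (b \<bullet> (Q *v e i)))"
      by (simp add: inner_sum_left)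
    also have "\<dots> = (\<Sum>b\<in>B. (b \<bullet> e i) * (b \<bullet> e i))"
    proof (rule sum.cong)
      fix b assume "b \<in> B"
      then have "Q *v b = b" using B(4) orth_proj_range[OF assms, of b] span_base by metis
      then have "(Q *v e i) \<bullet> b = b \<bullet> e i"
        using orth_proj_inner[OF assms, of "e i" b] by (simp add: inner_commute)
      then show "((Q *v e i) \<bullet> b) * (b \<bullet> (Q *v e i)) = (b \<bullet> e i) * (b \<bullet> e i)"
        by (simp add: inner_commute)
    qed simp
    finally show ?thesis .
  qed
  have "(\<Sum>i\<in>{1..CARD('n)}. (Q *v e i) \<bullet> (Q *v e i)) = (\<Sum>b\<in>B. \<Sum>i\<in>{1..CARD('n)}. (b \<bullet> e i) * (b \<bullet> e i))"
    unfolding expand by (rule sum.swap)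
  also have "\<dots> = (\<Sum>b\<in>B. 1)"
    using B(2) by (intro sum.cong refl) (simp add: parseval norm_eq_1)
  finally show ?thesis by (simp add: B(5) rank_dim_range)
qed

lemma basis_eqI:
  assumes "\<And>i. i \<in> {1..CARD('n)} \<Longrightarrow> x \<bullet> e i = y \<bullet> e i"
  shows "x = y"
  using basis_expand[of x] basis_expand[of y] assms by (metis (no_types, lifting) sum.cong)

lemma basis_unit: "i \<in> {1..CARD('n)} \<Longrightarrow> e i \<bullet> e i = 1"
  using orthonormal by simp

lemma H_inner_basis:
  assumes "i \<in> {1..CARD('n)}"
  shows "(H *v x) \<bullet> e i = lam i * (x \<bullet> e i)"
proof -
  have "H *v x = H *v (\<Sum>j\<in>{1..CARD('n)}. (x \<bullet> e j) *\<^sub>R e j)"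
    by (simp only: basis_expand)
  also have "\<dots> = (\<Sum>j\<in>{1..CARD('n)}. (x \<bullet> e j * lam j) *\<^sub>R e j)"
    unfolding linear_sum[OF matrix_vector_mul_linear] by (simp add: matrix_vector_mult_scaleR eigen)
  finally have "(H *v x) \<bullet> e i = (\<Sum>j\<in>{1..CARD('n)}. if j = i then x \<bullet> e j * lam j else 0)"
    unfolding inner_sum_left inner_scaleR_left using assms by (simp add: inner_sum_left orthonormal if_distrib cong: if_cong)
  then show ?thesis using assms by simp
qed

lemma eigenvector_inner_basis:
  assumes "H *v x = \<mu> *\<^sub>R x" "i \<in> {1..CARD('n)}" "lam i \<noteq> \<mu>"
  shows "x \<bullet> e i = 0"
  using H_inner_basis[OF assms(2), of x] assms by simp

lemma rank_orth_proj_trace: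
  assumes "orth_proj Q"
  shows "real (rank Q) = (\<Sum>i\<in>{1..CARD('n)}. e i \<bullet> (Q *v e i))"
  using rank_orth_proj[OF assms] by (simp add: orth_proj_norm[OF assms])

section \<open>Projections onto dominant eigenspaces\<close>

text \<open>The projections onto \<open>s\<close>-dimensional spaces that contain all eigenspaces above \<open>lam s\<close> and lie
  in the sum of the eigenspaces from \<open>lam s\<close> upwards. Only the part inside the eigenspace of \<open>lam s\<close>
  is free, so exactly a tie between positions \<open>s\<close> and \<open>s + 1\<close> makes them nonunique.\<close>
definition top_proj :: "nat \<Rightarrow> real^'n^'n \<Rightarrow> bool" where
  "top_proj s Q \<longleftrightarrow> orth_proj Q \<and> rank Q = s \<and>
     (\<forall>i\<in>{1..CARD('n)}. (lam s < lam i \<longrightarrow> Q *v e i = e i) \<and> (lam i < lam s \<longrightarrow> Q *v e i = 0))"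

lemma top_projD:
  assumes "top_proj s Q"
  shows "orth_proj Q" "rank Q = s"
    "i \<in> {1..CARD('n)} \<Longrightarrow> lam s < lam i \<Longrightarrow> Q *v e i = e i"
    "i \<in> {1..CARD('n)} \<Longrightarrow> lam i < lam s \<Longrightarrow> Q *v e i = 0"
  using assms by (auto simp: top_proj_def)

lemma inner_orth_proj:
  assumes "orth_proj Q"
  shows "Q \<bullet> H = (\<Sum>i\<in>{1..CARD('n)}. lam i * ((Q *v e i) \<bullet> (Q *v e i)))"
  unfolding matrix_inner_basis
  by (intro sum.cong refl) (simp add: eigen orth_proj_norm[OF assms] inner_commute)

text \<open>Write \<open>t i = |Q e i|\<^sup>2\<close>. The eigenvalue sum and \<open>Q \<bullet> H = (\<Sum>i. lam i * t i)\<close> are compared after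
  shifting all eigenvalues by \<open>lam s\<close>; since \<open>(\<Sum>i. t i) = rank Q\<close>, the shift only leaves the rank
  defect. For \<open>i \<le> s\<close> both factors of a summand are nonnegative, for \<open>i > s\<close> both are
  nonpositive.\<close>
lemma ky_fan_defect:
  assumes s: "1 \<le> s" "s \<le> CARD('n)" and Q: "orth_proj Q"
  shows "(\<Sum>i=1..s. lam i) - Q \<bullet> H =
    (\<Sum>i\<in>{1..CARD('n)}. (lam i - lam s) * ((if i \<le> s then 1 else 0) - (Q *v e i) \<bullet> (Q *v e i)))
      + lam s * (real s - real (rank Q))"
proof -
  have sub: "{1..s} = {i \<in> {1..CARD('n)}. i \<le> s}" using s by auto
  have "(\<Sum>i=1..s. lam i) = (\<Sum>i\<in>{1..CARD('n)}. lam i * (if i \<le> s then 1 else 0))"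
    unfolding sub by (subst sum.inter_filter) (auto intro!: sum.cong)
  moreover have "(\<Sum>i\<in>{1..s}. 1) = (\<Sum>i\<in>{1..CARD('n)}. if i \<le> s then 1 else (0::real))"
    unfolding sub by (subst sum.inter_filter) auto
  then have "real s = (\<Sum>i\<in>{1..CARD('n)}. if i \<le> s then 1 else 0)" by simp
  ultimately show ?thesis
    unfolding inner_orth_proj[OF Q] rank_orth_proj[OF Q]
    by (simp add: sum_distrib_left sum_subtractf[symmetric] sum.distrib[symmetric] algebra_simps)
qed

text \<open>Ky Fan's maximum principle. In the equality case every summand of the defect vanishes, which
  forces \<open>t i = 1\<close> above the threshold \<open>lam s\<close> and \<open>t i = 0\<close> below it.\<close>
lemma ky_fan:
  assumes s: "1 \<le> s" "s \<le> CARD('n)" "0 < lam s" and Q: "orth_proj Q" "rank Q \<le> s"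
  shows "Q \<bullet> H \<le> (\<Sum>i=1..s. lam i)"
    and "Q \<bullet> H = (\<Sum>i=1..s. lam i) \<longleftrightarrow> top_proj s Q"
proof -
  define w where "w i = (lam i - lam s) * ((if i \<le> s then 1 else 0) - (Q *v e i) \<bullet> (Q *v e i))" for i
  note defect = ky_fan_defect[OF s(1,2) Q(1), folded w_def]
  have le1: "(Q *v e i) \<bullet> (Q *v e i) \<le> 1" if "i \<in> {1..CARD('n)}" for i
    using orth_proj_le[OF Q(1), of "e i"] that by (simp add: basis_unit)
  have mono: "lam s \<le> lam i" if "i \<in> {1..CARD('n)}" "i \<le> s" for i
    using decreasing that s by auto
  have mono': "lam i \<le> lam s" if "i \<in> {1..CARD('n)}" "\<not> i \<le> s" for i
    using decreasing that s by auto
  have w0: "w i \<ge> 0" if "i \<in> {1..CARD('n)}" for i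
  proof (cases "i \<le> s")
    case True then show ?thesis using le1[OF that] mono[OF that] by (simp add: w_def)
  next
    case False then show ?thesis using mono'[OF that] by (simp add: w_def mult_nonpos_nonneg)
  qed
  have rk: "lam s * (real s - real (rank Q)) \<ge> 0" using s Q by simp
  have sw: "(\<Sum>i\<in>{1..CARD('n)}. w i) \<ge> 0" by (intro sum_nonneg w0)
  show "Q \<bullet> H \<le> (\<Sum>i=1..s. lam i)"
    using defect rk sw by linarith
  have "Q \<bullet> H = (\<Sum>i=1..s. lam i) \<longleftrightarrow> (\<forall>i\<in>{1..CARD('n)}. w i = 0) \<and> rank Q = s"
  proof -
    have "Q \<bullet> H = (\<Sum>i=1..s. lam i) \<longleftrightarrow> (\<Sum>i\<in>{1..CARD('n)}. w i) = 0 \<and> lam s * (real s - real (rank Q)) = 0"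
      using defect rk sw by linarith
    moreover have "(\<Sum>i\<in>{1..CARD('n)}. w i) = 0 \<longleftrightarrow> (\<forall>i\<in>{1..CARD('n)}. w i = 0)"
      by (intro sum_nonneg_eq_0_iff w0) simp_all
    ultimately show ?thesis using s(3) by auto
  qed
  also have "\<dots> \<longleftrightarrow> top_proj s Q"
  proof -
    have "w i = 0 \<longleftrightarrow> (lam s < lam i \<longrightarrow> Q *v e i = e i) \<and> (lam i < lam s \<longrightarrow> Q *v e i = 0)"
      if i: "i \<in> {1..CARD('n)}" for i
    proof (cases "lam s" "lam i" rule: linorder_cases)
      case less
      then have "i \<le> s" using mono'[OF i] by force
      then have "w i = 0 \<longleftrightarrow> (Q *v e i) \<bullet> (Q *v e i) = 1" using less by (auto simp: w_def)
      also have "\<dots> \<longleftrightarrow> Q *v e i = e i"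
        using orth_proj_fixed[OF Q(1), of "e i"] basis_unit[OF i] by auto
      finally show ?thesis using less by auto
    next
      case greater
      then have "\<not> i \<le> s" using mono[OF i] by force
      then show ?thesis using greater by (auto simp: w_def)
    qed (simp add: w_def)
    then show ?thesis using Q(1) by (auto simp: top_proj_def)
  qed
  finally show "Q \<bullet> H = (\<Sum>i=1..s. lam i) \<longleftrightarrow> top_proj s Q" .
qed

lemma top_proj_exists:
  assumes s: "1 \<le> s" "s \<le> CARD('n)"
  obtains Q where "top_proj s Q"
proof -
  define Q where "Q = span_proj (e ` {1..s})"
  have sub: "{1..s} \<subseteq> {1..CARD('n)}" using s by auto
  have Q: "orth_proj Q"
    unfolding Q_def
  proof (rule orth_proj_span_proj)
    show "pairwise orthogonal (e ` {1..s})"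
      using basis_orthogonal sub by (meson image_mono pairwise_mono subset_refl pairwise_subset)
    show "norm b = 1" if "b \<in> e ` {1..s}" for b
      using that sub basis_unit by (auto simp: norm_eq_1)
  qed simp
  have Qe: "Q *v e i = (if i \<le> s then e i else 0)" if i: "i \<in> {1..CARD('n)}" for i
  proof -
    have "Q *v e i = (\<Sum>j\<in>{1..s}. (e j \<bullet> e i) *\<^sub>R e j)"
      unfolding Q_def span_proj_mult by (rule sum.reindex_cong[OF inj_on_subset[OF basis_inj sub]]) auto
    also have "\<dots> = (\<Sum>j\<in>{1..s}. if j = i then e j else 0)"
      using i sub by (intro sum.cong refl) (auto simp: orthonormal)
    finally show ?thesis using i by auto
  qed
  have "real (rank Q) = (\<Sum>i\<in>{1..CARD('n)}. if i \<le> s then 1 else 0)"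
    unfolding rank_orth_proj[OF Q] by (intro sum.cong refl) (simp add: Qe basis_unit)
  also have "\<dots> = real (card {i \<in> {1..CARD('n)}. i \<le> s})"
    by (subst sum.inter_filter[symmetric]) auto
  also have "{i \<in> {1..CARD('n)}. i \<le> s} = {1..s}" using s by auto
  finally have "rank Q = s" by simp
  moreover have "i \<le> s" if "i \<in> {1..CARD('n)}" "lam s < lam i" for i
    using that decreasing[of s i] s by force
  moreover have "\<not> i \<le> s" if "i \<in> {1..CARD('n)}" "lam i < lam s" for i
    using that decreasing[of i s] s by force
  ultimately have "top_proj s Q" using Q Qe by (simp add: top_proj_def)
  with that show ?thesis by blast
qed

text \<open>The only basis vectors on which \<open>Q\<close> is not prescribed belong to \<open>lam s\<close>. Their images are, by
  symmetry of \<open>Q\<close>, orthogonal to all other basis vectors, hence stay in that eigenspace.\<close>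
lemma top_proj_commutes:
  assumes Q: "top_proj s Q"
  shows "H *v (Q *v x) = Q *v (H *v x)"
proof -
  have "H ** Q = Q ** H"
  proof (rule matrix_eq_on_basis)
    fix i assume i: "i \<in> {1..CARD('n)}"
    have "H *v (Q *v e i) = lam i *\<^sub>R (Q *v e i)"
    proof (cases "lam i" "lam s" rule: linorder_cases)
      case equal
      show ?thesis
      proof (rule basis_eqI)
        fix j assume j: "j \<in> {1..CARD('n)}"
        have "(Q *v e i) \<bullet> e j = 0" if "lam j \<noteq> lam s"
        proof -
          have "i \<noteq> j" using that equal by auto
          then show ?thesis
            unfolding orth_proj_inner[OF top_projD(1)[OF Q]]
            using that top_projD(3,4)[OF Q j] orthonormal[OF i j] by (cases "lam s < lam j") auto
        qed
        then show "(H *v (Q *v e i)) \<bullet> e j = (lam i *\<^sub>R (Q *v e i)) \<bullet> e j"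
          using H_inner_basis[OF j] equal by auto
      qed
    qed (use top_projD(3,4)[OF Q i] eigen[OF i] in auto)
    then show "(H ** Q) *v e i = (Q ** H) *v e i"
      by (simp add: eigen[OF i] matrix_vector_mult_scaleR flip: matrix_vector_mul_assoc)
  qed
  then show ?thesis by (simp add: matrix_vector_mul_assoc)
qed

text \<open>With a gap after position \<open>s\<close>, \<open>Q\<close> vanishes on the later basis vectors, and its trace \<open>s\<close> has
  to come from the first \<open>s\<close> of them, each contributing at most 1.\<close>
lemma top_proj_gap:
  assumes s: "1 \<le> s" "s \<le> CARD('n)" and gap: "s < CARD('n) \<Longrightarrow> lam (s + 1) < lam s"
    and Q: "top_proj s Q" and i: "i \<in> {1..CARD('n)}"
  shows "Q *v e i = (if i \<le> s then e i else 0)"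
proof -
  note op = top_projD(1)[OF Q]
  have beyond: "lam j < lam s" if "j \<in> {1..CARD('n)}" "\<not> j \<le> s" for j
    using gap decreasing[of "s + 1" j] that by force
  define t where "t j = (Q *v e j) \<bullet> (Q *v e j)" for j
  have "(\<Sum>j\<in>{1..s}. t j) = (\<Sum>j\<in>{1..CARD('n)}. t j)"
    using s beyond top_projD(4)[OF Q] by (intro sum.mono_neutral_left) (auto simp: t_def)
  also have "\<dots> = (\<Sum>j\<in>{1..s}. 1)"
    using rank_orth_proj[OF op] top_projD(2)[OF Q] by (simp add: t_def)
  finally have "(\<Sum>j\<in>{1..s}. 1 - t j) = 0" by (simp add: sum_subtractf)
  moreover have "1 - t j \<ge> 0" if "j \<in> {1..s}" for j
    using orth_proj_le[OF op, of "e j"] that s basis_unit[of j] by (simp add: t_def)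
  ultimately have "\<forall>j\<in>{1..s}. 1 - t j = 0" by (subst (asm) sum_nonneg_eq_0_iff) auto
  then have "Q *v e i = e i" if "i \<le> s"
    using that i orth_proj_fixed[OF op, of "e i"] basis_unit[OF i] by (simp add: t_def)
  then show ?thesis using beyond[OF i] top_projD(4)[OF Q i] by auto
qed

lemma top_proj_unique:
  assumes "1 \<le> s" "s \<le> CARD('n)" "s < CARD('n) \<Longrightarrow> lam (s + 1) < lam s" "top_proj s Q" "top_proj s R"
  shows "Q = R"
  using top_proj_gap[OF assms(1-3) assms(4)] top_proj_gap[OF assms(1-3) assms(5)]
  by (intro matrix_eq_on_basis) simp

text \<open>If \<open>lam s < lam r\<close>, then the range of \<open>Q\<close> lies in eigenspaces above \<open>lam s\<close>, on which \<open>R\<close> is the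
  identity. If \<open>lam r = lam s > lam (s + 1)\<close>, then the range of \<open>R\<close> consists of all eigenspaces from
  \<open>lam r\<close> upwards. When one eigenvalue extends over all positions from \<open>r\<close> to \<open>s + 1\<close>, both ranges
  choose freely in the same eigenspace, and the inclusion has to be assumed.\<close>
lemma top_proj_nested:
  assumes r: "1 \<le> r" "r \<le> s" "s \<le> CARD('n)" and Q: "top_proj r Q" and R: "top_proj s R"
    and compat: "s < CARD('n) \<Longrightarrow> lam r = lam (s + 1) \<Longrightarrow> range ((*v) Q) \<subseteq> range ((*v) R)"
  shows "R ** Q = Q"
proof (cases "s < CARD('n) \<and> lam r = lam (s + 1)")
  case True
  then have "R *v (Q *v x) = Q *v x" for x
    using compat orth_proj_range[OF top_projD(1)[OF R], of "Q *v x"] by blast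
  then show ?thesis by (simp add: matrix_eq flip: matrix_vector_mul_assoc)
next
  case False
  have split: "Q *v e i = 0 \<or> R *v e i = e i" if i: "i \<in> {1..CARD('n)}" for i
  proof (cases "lam s < lam r")
    case True
    then show ?thesis using top_projD(4)[OF Q i] top_projD(3)[OF R i] by force
  next
    case same: False
    then have eq: "lam r = lam s" using decreasing[of r s] r by force
    have gap: "s < CARD('n) \<Longrightarrow> lam (s + 1) < lam s"
      using decreasing[of s "s + 1"] False eq r by force
    have "lam i < lam r" if "\<not> i \<le> s"
      using gap decreasing[of "s + 1" i] i that eq by force
    then show ?thesis
      using top_proj_gap[OF _ r(3) gap R i] top_projD(4)[OF Q i] r by auto
  qed
  have "R *v (Q *v x) = Q *v x" for x
  proof -
    have coeff: "((Q *v x) \<bullet> e i) *\<^sub>R (R *v e i) = ((Q *v x) \<bullet> e i) *\<^sub>R e i" if i: "i \<in> {1..CARD('n)}" for i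
      using split[OF i] orth_proj_inner[OF top_projD(1)[OF Q], of x "e i"] by auto
    have "R *v (Q *v x) = R *v (\<Sum>i\<in>{1..CARD('n)}. ((Q *v x) \<bullet> e i) *\<^sub>R e i)"
      by (simp only: basis_expand)
    also have "\<dots> = (\<Sum>i\<in>{1..CARD('n)}. ((Q *v x) \<bullet> e i) *\<^sub>R (R *v e i))"
      unfolding linear_sum[OF matrix_vector_mul_linear] by (simp add: matrix_vector_mult_scaleR)
    also have "\<dots> = (\<Sum>i\<in>{1..CARD('n)}. ((Q *v x) \<bullet> e i) *\<^sub>R e i)"
      by (intro sum.cong refl coeff)
    finally show ?thesis by (simp only: basis_expand)
  qed
  then show ?thesis by (simp add: matrix_eq flip: matrix_vector_mul_assoc)
qed

lemma rank_swap:
  fixes Q :: "real^'n^'n"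
  assumes Q: "orth_proj Q" and u: "norm u = 1" "Q *v u = u" and v: "norm v = 1" "Q *v v = 0"
  shows "rank (Q - span_proj {u} + span_proj {v}) = rank Q"
proof -
  have "real (rank (Q - span_proj {u} + span_proj {v}))
    = real (rank Q) - (\<Sum>i\<in>{1..CARD('n)}. (u \<bullet> e i) * (u \<bullet> e i)) + (\<Sum>i\<in>{1..CARD('n)}. (v \<bullet> e i) * (v \<bullet> e i))"
    unfolding rank_orth_proj_trace[OF orth_proj_swap[OF assms]] rank_orth_proj_trace[OF Q]
    by (simp add: mult_outer_swap inner_add_right inner_diff_right sum.distrib sum_subtractf
        inner_commute[of "e _"])
  then show ?thesis using u v by (simp add: parseval norm_eq_1)
qed

lemma top_proj_swap:
  assumes Q: "top_proj s Q" and u: "norm u = 1" "Q *v u = u" "H *v u = lam s *\<^sub>R u"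
    and v: "norm v = 1" "Q *v v = 0" "H *v v = lam s *\<^sub>R v"
  shows "top_proj s (Q - span_proj {u} + span_proj {v})"
proof -
  have "u \<bullet> e i = 0" "v \<bullet> e i = 0" if "i \<in> {1..CARD('n)}" "lam i \<noteq> lam s" for i
    using eigenvector_inner_basis that u v by auto
  then show ?thesis
    using Q rank_swap[OF _ u(1,2) v(1,2)] orth_proj_swap[OF _ u(1,2) v(1,2)]
    by (auto simp: top_proj_def mult_outer_swap)
qed

lemma normalized_eigenvector:
  assumes "x \<noteq> 0" "H *v x = \<mu> *\<^sub>R x"
  shows "norm (x /\<^sub>R norm x) = 1" "H *v (x /\<^sub>R norm x) = \<mu> *\<^sub>R (x /\<^sub>R norm x)"
  using assms by (auto simp: matrix_vector_mult_scaleR)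

text \<open>In case of a tie after position \<open>s\<close>, a projection of rank \<open>s\<close> cannot fix the \<open>s + 1\<close> leading
  basis vectors; the component of one of them orthogonal to the range is an eigenvector.\<close>
lemma top_proj_outside:
  assumes s: "1 \<le> s" "s < CARD('n)" "lam (s + 1) = lam s" and Q: "top_proj s Q"
  obtains v where "norm v = 1" "Q *v v = 0" "H *v v = lam s *\<^sub>R v"
proof -
  have "\<exists>i\<in>{1..CARD('n)}. lam i = lam s \<and> Q *v e i \<noteq> e i"
  proof (rule ccontr)
    assume "\<not> ?thesis"
    then have id: "Q *v e i = e i" if "i \<in> {1..s + 1}" for i
      using that s decreasing[of i "s + 1"] top_projD(3)[OF Q, of i] by force
    have "real (s + 1) = (\<Sum>i\<in>{1..s + 1}. (Q *v e i) \<bullet> (Q *v e i))"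
      using s by (simp add: id basis_unit)
    also have "\<dots> \<le> (\<Sum>i\<in>{1..CARD('n)}. (Q *v e i) \<bullet> (Q *v e i))"
      using s by (intro sum_mono2) auto
    also have "\<dots> = real s"
      using rank_orth_proj[OF top_projD(1)[OF Q]] top_projD(2)[OF Q] by simp
    finally show False by simp
  qed
  then obtain i where i: "i \<in> {1..CARD('n)}" "lam i = lam s" "e i - Q *v e i \<noteq> 0" by auto
  have "H *v (e i - Q *v e i) = lam s *\<^sub>R (e i - Q *v e i)"
    using i eigen[OF i(1)] by (simp add: matrix_vector_mult_diff_distrib top_proj_commutes[OF Q]
        matrix_vector_mult_scaleR scaleR_diff_right)
  moreover have "Q *v (e i - Q *v e i) = 0"
    by (simp add: matrix_vector_mult_diff_distrib orth_proj_mult[OF top_projD(1)[OF Q]])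
  ultimately show ?thesis
    using that[of "(e i - Q *v e i) /\<^sub>R norm (e i - Q *v e i)"] normalized_eigenvector i(3)
    by (simp add: matrix_vector_mult_scaleR)
qed

text \<open>Otherwise only the first \<open>s - 1\<close> basis vectors would contribute to the trace \<open>s\<close>.\<close>
lemma top_proj_meets_eigenspace:
  assumes s: "1 \<le> s" "s \<le> CARD('n)" and Q: "top_proj s Q"
  obtains i where "i \<in> {1..CARD('n)}" "lam i = lam s" "Q *v e i \<noteq> 0"
proof -
  have "\<exists>i\<in>{1..CARD('n)}. lam i = lam s \<and> Q *v e i \<noteq> 0"
  proof (rule ccontr)
    assume "\<not> ?thesis"
    then have zero: "Q *v e i = 0" if "i \<in> {1..CARD('n)}" "s \<le> i" for i
      using that s decreasing[of s i] top_projD(4)[OF Q, of i] by force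
    have "real s = (\<Sum>i\<in>{1..CARD('n)}. (Q *v e i) \<bullet> (Q *v e i))"
      using rank_orth_proj[OF top_projD(1)[OF Q]] top_projD(2)[OF Q] by simp
    also have "\<dots> = (\<Sum>i\<in>{1..s - 1}. (Q *v e i) \<bullet> (Q *v e i))"
      using s by (intro sum.mono_neutral_right) (auto simp: zero)
    also have "\<dots> \<le> (\<Sum>i\<in>{1..s - 1}. 1)"
    proof (rule sum_mono)
      fix i assume "i \<in> {1..s - 1}"
      then have "e i \<bullet> e i = 1" using s by (intro basis_unit) auto
      then show "(Q *v e i) \<bullet> (Q *v e i) \<le> 1"
        using orth_proj_le[OF top_projD(1)[OF Q], of "e i"] by simp
    qed
    finally show False using s by simp
  qed
  with that show ?thesis by blast
qed

lemma top_proj_inside: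
  assumes "1 \<le> s" "s \<le> CARD('n)" and Q: "top_proj s Q"
  obtains u where "norm u = 1" "Q *v u = u" "H *v u = lam s *\<^sub>R u"
proof -
  obtain i where i: "i \<in> {1..CARD('n)}" "lam i = lam s" "Q *v e i \<noteq> 0"
    using top_proj_meets_eigenspace[OF assms] .
  have "H *v (Q *v e i) = lam s *\<^sub>R (Q *v e i)"
    by (simp add: top_proj_commutes[OF Q] eigen[OF i(1)] i(2) matrix_vector_mult_scaleR)
  then show ?thesis
    using that[of "(Q *v e i) /\<^sub>R norm (Q *v e i)"] normalized_eigenvector i(3)
      orth_proj_mult[OF top_projD(1)[OF Q], of "e i"]
    by (simp add: matrix_vector_mult_scaleR)
qed

text \<open>This vector can be removed from the range of \<open>R\<close> without destroying the inclusion of the range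
  of \<open>Q\<close>. For \<open>lam s < lam r\<close> the range of \<open>Q\<close> is orthogonal to the eigenspace of \<open>lam s\<close>, which
  \<open>R\<close> meets; for \<open>lam r = lam s\<close> the projections \<open>R\<close> and \<open>Q\<close> differ only on that eigenspace.\<close>
lemma top_proj_between:
  assumes r: "1 \<le> r" "r < s" "s \<le> CARD('n)" and Q: "top_proj r Q" and R: "top_proj s R"
    and nested: "R ** Q = Q"
  obtains u where "norm u = 1" "R *v u = u" "Q *v u = 0" "H *v u = lam s *\<^sub>R u"
proof -
  note oQ = top_projD(1)[OF Q] and oR = top_projD(1)[OF R]
  have "Q ** R = Q"
    using oQ oR nested by (metis matrix_transpose_mul orth_proj_def)
  then have QR: "Q *v (R *v x) = Q *v x" and RQ: "R *v (Q *v x) = Q *v x" for x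
    using nested by (auto simp: matrix_vector_mul_assoc)
  have "\<exists>i\<in>{1..CARD('n)}. lam i = lam s \<and> R *v e i - Q *v e i \<noteq> 0"
  proof (cases "lam s < lam r")
    case True
    obtain i where "i \<in> {1..CARD('n)}" "lam i = lam s" "R *v e i \<noteq> 0"
      using top_proj_meets_eigenspace[OF _ r(3) R] r by auto
    then show ?thesis using True top_projD(4)[OF Q, of i] by force
  next
    case False
    then have eq: "lam r = lam s" using decreasing[of r s] r by force
    show ?thesis
    proof (rule ccontr)
      assume "\<not> ?thesis"
      then have "R *v e i = Q *v e i" if "i \<in> {1..CARD('n)}" for i
        using that eq top_projD(3,4)[OF Q that] top_projD(3,4)[OF R that]
        by (cases "lam i" "lam s" rule: linorder_cases) auto
      then have "R = Q" by (rule matrix_eq_on_basis)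
      then show False using top_projD(2)[OF Q] top_projD(2)[OF R] r by simp
    qed
  qed
  then obtain i where i: "i \<in> {1..CARD('n)}" "lam i = lam s" "R *v e i - Q *v e i \<noteq> 0" by auto
  let ?x = "R *v e i - Q *v e i"
  have "H *v ?x = lam s *\<^sub>R ?x"
    by (simp add: matrix_vector_mult_diff_distrib top_proj_commutes[OF Q] top_proj_commutes[OF R]
        eigen[OF i(1)] i(2) matrix_vector_mult_scaleR scaleR_diff_right)
  moreover have "R *v ?x = ?x" "Q *v ?x = 0"
    by (simp_all add: matrix_vector_mult_diff_distrib orth_proj_mult[OF oQ] orth_proj_mult[OF oR] QR RQ)
  ultimately show ?thesis
    using that[of "?x /\<^sub>R norm ?x"] normalized_eigenvector i(3)
    by (simp add: matrix_vector_mult_scaleR)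
qed

end

section \<open>Low-rank approximation in a weighted Frobenius norm\<close>

text \<open>Approximation of \<open>Zs\<close> by matrices of bounded rank in the norm of \<open>X ** G\<close>. Cancelling \<open>G\<close>
  replaces a square root of the weight \<open>G ** transpose G\<close>.\<close>
locale low_rank_problem = ordered_eigenbasis H lam e
  for H :: "real^'n^'n" and lam :: "nat \<Rightarrow> real" and e :: "nat \<Rightarrow> real^'n" +
  fixes Zs :: "real^'m^'n" and G :: "real^'q^'m"
  assumes H_eq: "H = (Zs ** G) ** transpose (Zs ** G)"
    and G_cancel: "\<And>X :: real^'m^'n. X ** G = 0 \<Longrightarrow> X = 0"
begin

definition err :: "real^'m^'n \<Rightarrow> real" where
  "err Z = (norm ((Z - Zs) ** G))\<^sup>2"

definition best :: "nat \<Rightarrow> real^'m^'n \<Rightarrow> bool" where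
  "best s Z \<longleftrightarrow> is_arg_min err (\<lambda>Z. rank Z \<le> s) Z"

lemma best_iff: "best s Z \<longleftrightarrow> rank Z \<le> s \<and> (\<forall>Y. rank Y \<le> s \<longrightarrow> err Z \<le> err Y)"
  by (simp add: best_def is_arg_min_linorder)

text \<open>The error splits into its component in the range of \<open>Q\<close>, which vanishes for \<open>Z = Q ** Zs\<close>, and
  the component of \<open>Zs ** G\<close> outside that range.\<close>
lemma err_decomposition:
  assumes Q: "orth_proj Q" and Z: "Q ** Z = Z"
  shows "err Z = (norm (Q ** ((Z - Zs) ** G)))\<^sup>2 + ((norm (Zs ** G))\<^sup>2 - Q \<bullet> H)"
proof -
  have "(norm (Q ** (Zs ** G)))\<^sup>2 = Q \<bullet> H"
    unfolding orth_proj_matrix_norm[OF Q] H_eq by (rule matrix_inner_mult_right)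
  moreover have "(Z - Zs) ** G - Q ** ((Z - Zs) ** G) = - (Zs ** G - Q ** (Zs ** G))"
    using Z by (simp add: matrix_mult_diff_left matrix_mult_diff_right matrix_mul_assoc)
  ultimately show ?thesis
    using orth_proj_matrix_pythagoras[OF Q, of "(Z - Zs) ** G"]
      orth_proj_matrix_pythagoras[OF Q, of "Zs ** G"]
    by (simp only: err_def norm_minus_cancel)
qed

text \<open>Applied to the projection onto the column space of \<open>Z\<close>, the decomposition of the error and Ky Fan's
  principle give the bound; equality in it forces equality in both.\<close>
lemma err_ge:
  assumes s: "1 \<le> s" "s \<le> CARD('n)" "0 < lam s" and Z: "rank Z \<le> s"
  shows "(norm (Zs ** G))\<^sup>2 - (\<Sum>i=1..s. lam i) \<le> err Z"
    and "err Z = (norm (Zs ** G))\<^sup>2 - (\<Sum>i=1..s. lam i) \<Longrightarrow>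
      \<exists>Q. top_proj s Q \<and> Z = Q ** Zs \<and> range ((*v) Q) = range ((*v) Z)"
proof -
  obtain Q where Q: "orth_proj Q" "range ((*v) Q) = range ((*v) Z)"
    using orth_proj_onto_subspace[of "range ((*v) Z)"]
    by (metis linear_subspace_image matrix_vector_mul_linear subspace_UNIV)
  have "Q *v (Z *v x) = Z *v x" for x
    using orth_proj_range[OF Q(1), of "Z *v x"] Q(2) by auto
  then have QZ: "Q ** Z = Z" by (simp add: matrix_eq flip: matrix_vector_mul_assoc)
  have rQ: "rank Q \<le> s" using Z Q(2) by (simp add: rank_dim_range)
  note kf = ky_fan[OF s Q(1) rQ]
  note dec = err_decomposition[OF Q(1) QZ]
  show "(norm (Zs ** G))\<^sup>2 - (\<Sum>i=1..s. lam i) \<le> err Z"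
    using kf(1) dec by (smt (verit) zero_le_power2)
  assume "err Z = (norm (Zs ** G))\<^sup>2 - (\<Sum>i=1..s. lam i)"
  then have "(norm (Q ** ((Z - Zs) ** G)))\<^sup>2 = 0" and "Q \<bullet> H = (\<Sum>i=1..s. lam i)"
    using kf(1) dec by (smt (verit) zero_le_power2)+
  then have "Q ** (Z - Zs) = 0" and top: "top_proj s Q"
    using kf(2) G_cancel[of "Q ** (Z - Zs)"] by (auto simp: matrix_mul_assoc)
  then have "Z = Q ** Zs" using QZ by (simp add: matrix_mult_diff_right)
  with top Q(2) show "\<exists>Q. top_proj s Q \<and> Z = Q ** Zs \<and> range ((*v) Q) = range ((*v) Z)"
    by blast
qed

lemma top_proj_err:
  assumes s: "1 \<le> s" "s \<le> CARD('n)" "0 < lam s" and Q: "top_proj s Q"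
  shows "rank (Q ** Zs) \<le> s" "err (Q ** Zs) = (norm (Zs ** G))\<^sup>2 - (\<Sum>i=1..s. lam i)"
proof -
  note op = top_projD(1)[OF Q] and rk = top_projD(2)[OF Q]
  have QQ: "Q ** (Q ** X) = Q ** X" for X :: "real^'k^'n"
    using op by (simp add: orth_proj_def matrix_mul_assoc)
  show "rank (Q ** Zs) \<le> s"
    using rank_mul_le_left[of Q Zs] rk by simp
  have "Q ** ((Q ** Zs - Zs) ** G) = 0"
    by (simp add: matrix_mult_diff_left matrix_mult_diff_right QQ flip: matrix_mul_assoc)
  then show "err (Q ** Zs) = (norm (Zs ** G))\<^sup>2 - (\<Sum>i=1..s. lam i)"
    using err_decomposition[OF op QQ[of Zs]] ky_fan(2)[OF s op] rk Q by simp
qed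

lemma top_proj_best:
  assumes s: "1 \<le> s" "s \<le> CARD('n)" "0 < lam s" and Q: "top_proj s Q"
  shows "best s (Q ** Zs)"
  using top_proj_err[OF assms] err_ge(1)[OF s] by (simp add: best_iff)

lemma best_top_proj:
  assumes s: "1 \<le> s" "s \<le> CARD('n)" "0 < lam s" and Z: "best s Z"
  obtains Q where "top_proj s Q" "Z = Q ** Zs" "range ((*v) Q) = range ((*v) Z)"
proof -
  obtain R where R: "top_proj s R" using top_proj_exists s by blast
  have "err Z = (norm (Zs ** G))\<^sup>2 - (\<Sum>i=1..s. lam i)"
    using Z top_proj_err[OF s R] err_ge(1)[OF s, of Z] unfolding best_iff by force
  with err_ge(2)[OF s] Z that show ?thesis by (auto simp: best_iff)
qed

text \<open>Multiplying on the right by \<open>G ** transpose (Zs ** G)\<close> turns \<open>Zs\<close> into \<open>H\<close>, and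
  the two sides then differ at the eigenvector \<open>v\<close>.\<close>
lemma swap_changes_solution:
  assumes u: "norm u = 1" "Q *v u = u" and v: "norm v = 1" "Q *v v = 0" "H *v v = \<mu> *\<^sub>R v"
    and "orth_proj Q" "\<mu> \<noteq> 0"
  shows "(Q - span_proj {u} + span_proj {v}) ** Zs \<noteq> Q ** Zs"
proof
  let ?R = "Q - span_proj {u} + span_proj {v}"
  assume "?R ** Zs = Q ** Zs"
  then have "?R ** H = Q ** H" by (simp add: H_eq matrix_mul_assoc)
  then have "?R *v (H *v v) = Q *v (H *v v)" by (simp add: matrix_vector_mul_assoc)
  moreover have "u \<bullet> v = 0"
    using orth_proj_inner[OF assms(6), of u v] u v by simp
  ultimately have "\<mu> *\<^sub>R v = 0"
    using v by (simp add: mult_outer_swap matrix_vector_mult_scaleR norm_eq_1)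
  then show False using assms(7) v by auto
qed

lemma best_unique:
  assumes s: "1 \<le> s" "s \<le> CARD('n)" "0 < lam s" and gap: "s < CARD('n) \<Longrightarrow> lam (s + 1) < lam s"
    and "best s Y" "best s Z"
  shows "Y = Z"
  using best_top_proj[OF s assms(5)] best_top_proj[OF s assms(6)] top_proj_unique[OF s(1,2) gap]
  by metis

text \<open>Differences of projections onto nested ranges are projections, so their rank is the
  difference of the ranks.\<close>
lemma rank_nested_difference:
  assumes "orth_proj Q" "orth_proj R" "R ** Q = Q"
  shows "rank (R ** Zs - Q ** Zs) \<le> rank R - rank Q"
proof -
  note op = orth_proj_diff[OF assms(2,1,3)]
  have "real (rank (R - Q)) = real (rank R) - real (rank Q)"
    unfolding rank_orth_proj_trace[OF op] rank_orth_proj_trace[OF assms(1)] rank_orth_proj_trace[OF assms(2)]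
    by (simp add: matrix_vector_mult_diff_rdistrib inner_diff_right sum_subtractf)
  moreover have "rank ((R - Q) ** Zs) \<le> rank (R - Q)"
    by (rule rank_mul_le_left)
  ultimately show ?thesis by (simp add: matrix_mult_diff_left)
qed

text \<open>Because \<open>rank (Z0 + Z) \<le> r + l\<close>, updates of a best rank-\<open>r\<close> matrix \<open>Z0\<close> compete with
  the best matrices of rank \<open>r + l\<close>, and nestedness of the projections lets the difference reach their
  value. Hence the optimal updates of \<open>Z0\<close> are exactly the differences, of rank at most \<open>l\<close>, between
  a best matrix of rank \<open>r + l\<close> and \<open>Z0\<close>. A tie at \<open>r + l\<close> gives a second such matrix by
  swapping an eigenvector in the range of \<open>R\<close> against one outside; a tie at \<open>r\<close> gives in the same way
  a second \<open>Z0\<close>, and its update differs since the sum is the same.\<close>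
lemma low_rank_update:
  fixes Zr Zrl :: "real^'m^'n"
  assumes r: "0 < r" and l: "0 < l" and n: "r + l \<le> CARD('n)" and pos: "0 < lam (r + l)"
    and Zr: "best r Zr" and Zrl: "best (r + l) Zrl"
    and compat: "\<lbrakk>r + l < CARD('n); lam r = lam (r + l + 1)\<rbrakk> \<Longrightarrow> range ((*v) Zr) \<subseteq> range ((*v) Zrl)"
  defines "upd \<equiv> \<lambda>Z0. is_arg_min (\<lambda>Z. err (Z0 + Z)) (\<lambda>Z. rank Z \<le> l)"
  defines "gap \<equiv> \<lambda>s. s < CARD('n) \<longrightarrow> lam (s + 1) < lam s"
  shows "rank (Zrl - Zr) \<le> l" "upd Zr (Zrl - Zr)"
    "(\<forall>Z. upd Zr Z \<longrightarrow> Z = Zrl - Zr) \<longleftrightarrow> gap (r + l)"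
    "(\<forall>Zr' Z. best r Zr' \<and> upd Zr' Z \<longrightarrow> Z = Zrl - Zr) \<longleftrightarrow> gap r \<and> gap (r + l)"
proof -
  have rr: "1 \<le> r" "r \<le> CARD('n)" "0 < lam r"
    using r n pos decreasing[of r "r + l"] by auto
  have tt: "1 \<le> r + l" "r + l \<le> CARD('n)" "0 < lam (r + l)" using r n pos by auto
  obtain R where R: "top_proj (r + l) R" "Zrl = R ** Zs" "range ((*v) R) = range ((*v) Zrl)"
    using best_top_proj[OF tt Zrl] .
  have nested: "R ** Q = Q"
    if "top_proj r Q" "r + l < CARD('n) \<Longrightarrow> lam r = lam (r + l + 1) \<Longrightarrow> range ((*v) Q) \<subseteq> range ((*v) R)" for Q
    using top_proj_nested[OF rr(1) _ tt(2) that(1) R(1)] that(2) by simp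
  have rank_diff: "rank (Zrl - Q ** Zs) \<le> l" if "top_proj r Q" "R ** Q = Q" for Q
    using rank_nested_difference[OF top_projD(1)[OF that(1)] top_projD(1)[OF R(1)] that(2)]
      top_projD(2)[OF that(1)] top_projD(2)[OF R(1)] R(2) by simp
  have upd_best: "upd Z0 Z \<longleftrightarrow> rank Z \<le> l \<and> best (r + l) (Z0 + Z)"
    if Z0: "best r Z0" "rank (Zrl - Z0) \<le> l" for Z0 Z
  proof
    assume "upd Z0 Z"
    then have Z: "rank Z \<le> l" "err (Z0 + Z) \<le> err (Z0 + (Zrl - Z0))"
      using Z0(2) by (auto simp: upd_def is_arg_min_linorder)
    have "rank (Z0 + Z) \<le> r + l"
      using rank_add_le[of Z0 Z] Z0(1) Z(1) by (simp add: best_iff)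
    then show "rank Z \<le> l \<and> best (r + l) (Z0 + Z)"
      using Zrl Z by (auto simp: best_iff intro: order_trans)
  next
    assume Z: "rank Z \<le> l \<and> best (r + l) (Z0 + Z)"
    have "rank (Z0 + Y) \<le> r + l" if "rank Y \<le> l" for Y
      using rank_add_le[of Z0 Y] Z0(1) that by (simp add: best_iff)
    then show "upd Z0 Z" using Z by (auto simp: upd_def is_arg_min_linorder best_iff)
  qed
  obtain Q where Q: "top_proj r Q" "Zr = Q ** Zs" "range ((*v) Q) = range ((*v) Zr)"
    using best_top_proj[OF rr Zr] .
  have RQ: "R ** Q = Q" using nested[OF Q(1)] compat Q(3) R(3) by simp
  show rk: "rank (Zrl - Zr) \<le> l" using rank_diff[OF Q(1) RQ] Q(2) by simp
  show "upd Zr (Zrl - Zr)" using upd_best[OF Zr rk] rk Zrl by simp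
  show first: "(\<forall>Z. upd Zr Z \<longrightarrow> Z = Zrl - Zr) \<longleftrightarrow> gap (r + l)"
  proof
    assume "gap (r + l)"
    then show "\<forall>Z. upd Zr Z \<longrightarrow> Z = Zrl - Zr"
      using best_unique[OF tt _ _ Zrl] upd_best[OF Zr rk] unfolding gap_def
      by (metis add_diff_cancel_left')
  next
    assume unique: "\<forall>Z. upd Zr Z \<longrightarrow> Z = Zrl - Zr"
    show "gap (r + l)"
    proof (rule ccontr)
      assume "\<not> gap (r + l)"
      then have lt: "r + l < CARD('n)" and eq: "lam (r + l + 1) = lam (r + l)"
        using decreasing[of "r + l" "r + l + 1"] r by (auto simp: gap_def)
      \<comment> \<open>Removing a vector orthogonal to the range of \<open>Q\<close> keeps the new projection \<open>R'\<close> above \<open>Q\<close>.\<close>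
      obtain u where u: "norm u = 1" "R *v u = u" "Q *v u = 0" "H *v u = lam (r + l) *\<^sub>R u"
        using top_proj_between[OF rr(1) _ tt(2) Q(1) R(1) RQ] l by auto
      obtain v where v: "norm v = 1" "R *v v = 0" "H *v v = lam (r + l) *\<^sub>R v"
        using top_proj_outside[OF tt(1) lt eq R(1)] .
      define R' where "R' = R - span_proj {u} + span_proj {v}"
      have R': "top_proj (r + l) R'"
        unfolding R'_def by (rule top_proj_swap[OF R(1) u(1,2,4) v])
      have oQ: "orth_proj Q" using top_projD(1)[OF Q(1)] .
      have "Q *v v = 0"
      proof -
        have "Q ** R = Q"
          using oQ top_projD(1)[OF R(1)] RQ by (metis matrix_transpose_mul orth_proj_def)
        then have "Q *v v = Q *v (R *v v)" by (simp add: matrix_vector_mul_assoc)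
        then show ?thesis by (simp add: v)
      qed
      then have "u \<bullet> (Q *v x) = 0" "v \<bullet> (Q *v x) = 0" for x
        using orth_proj_inner[OF oQ, of u x] orth_proj_inner[OF oQ, of v x] u by auto
      then have "R' ** Q = Q"
        using RQ by (simp add: matrix_eq R'_def mult_outer_swap flip: matrix_vector_mul_assoc)
      then have "rank (R' ** Zs - Zr) \<le> l"
        using rank_nested_difference[OF oQ top_projD(1)[OF R']] top_projD(2)[OF R'] top_projD(2)[OF Q(1)] Q(2)
        by simp
      then have "upd Zr (R' ** Zs - Zr)"
        using upd_best[OF Zr rk] top_proj_best[OF tt R'] by simp
      then have "R' ** Zs = R ** Zs" using unique R(2) by fastforce
      then show False
        using swap_changes_solution[OF u(1,2) v top_projD(1)[OF R(1)]] pos by (simp add: R'_def)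
    qed
  qed
  show "(\<forall>Zr' Z. best r Zr' \<and> upd Zr' Z \<longrightarrow> Z = Zrl - Zr) \<longleftrightarrow> gap r \<and> gap (r + l)"
  proof
    assume "gap r \<and> gap (r + l)"
    then show "\<forall>Zr' Z. best r Zr' \<and> upd Zr' Z \<longrightarrow> Z = Zrl - Zr"
      using first best_unique[OF rr _ _ Zr] unfolding gap_def by blast
  next
    assume unique: "\<forall>Zr' Z. best r Zr' \<and> upd Zr' Z \<longrightarrow> Z = Zrl - Zr"
    then have gt: "gap (r + l)" using Zr first by blast
    moreover have "gap r"
    proof (rule ccontr)
      assume "\<not> gap r"
      then have lt: "r < CARD('n)" and eq: "lam (r + 1) = lam r"
        using decreasing[of r "r + 1"] r by (auto simp: gap_def)
      obtain u where u: "norm u = 1" "Q *v u = u" "H *v u = lam r *\<^sub>R u"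
        using top_proj_inside[OF rr(1,2) Q(1)] .
      obtain v where v: "norm v = 1" "Q *v v = 0" "H *v v = lam r *\<^sub>R v"
        using top_proj_outside[OF rr(1) lt eq Q(1)] .
      define Q' where "Q' = Q - span_proj {u} + span_proj {v}"
      have Q': "top_proj r Q'"
        unfolding Q'_def by (rule top_proj_swap[OF Q(1) u v])
      have "R ** Q' = Q'"
      proof (rule nested[OF Q'])
        \<comment> \<open>The gap at \<open>r + l\<close> excludes the case in which nestedness could fail for \<open>Q'\<close>.\<close>
        assume "r + l < CARD('n)" "lam r = lam (r + l + 1)"
        then have False using gt decreasing[of r "r + l"] r n by (auto simp: gap_def)
        then show "range ((*v) Q') \<subseteq> range ((*v) R)" ..
      qed
      then have rk': "rank (Zrl - Q' ** Zs) \<le> l" by (rule rank_diff[OF Q'])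
      have b': "best r (Q' ** Zs)" by (rule top_proj_best[OF rr Q'])
      have "upd (Q' ** Zs) (Zrl - Q' ** Zs)" using upd_best[OF b' rk'] rk' Zrl by simp
      then have "Q' ** Zs = Q ** Zs" using unique b' Q(2) by fastforce
      then show False
        using swap_changes_solution[OF u(1,2) v top_projD(1)[OF Q(1)]] rr by (simp add: Q'_def)
    qed
    ultimately show "gap r \<and> gap (r + l)" by blast
  qed
qed

text \<open>Otherwise \<open>e i\<close> is orthogonal to the range of \<open>Zs\<close> for all \<open>i \<ge> s\<close>, since
  \<open>lam i = |transpose (Zs ** G) *v e i|\<^sup>2\<close>, and that range has dimension less than \<open>s\<close>.\<close>
lemma lam_pos:
  assumes s: "1 \<le> s" "s \<le> CARD('n)" "s \<le> rank Zs"
  shows "0 < lam s"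
proof (rule ccontr)
  assume neg: "\<not> 0 < lam s"
  have orth: "(Zs *v x) \<bullet> e i = 0" if i: "i \<in> {1..CARD('n)}" "s \<le> i" for i x
  proof -
    have "lam i \<le> 0" using decreasing[of s i] i s neg by simp
    moreover have "(transpose (Zs ** G) *v e i) \<bullet> (transpose (Zs ** G) *v e i) = lam i"
    proof -
      have "(H *v e i) \<bullet> e i = (transpose (Zs ** G) *v e i) \<bullet> (transpose (Zs ** G) *v e i)"
        unfolding matrix_inner_transpose[of "Zs ** G", symmetric]
        by (simp only: H_eq matrix_vector_mul_assoc)
      then show ?thesis using eigen[OF i(1)] basis_unit[OF i(1)] by simp
    qed
    ultimately have z: "transpose (Zs ** G) *v e i = 0"
      by (metis inner_eq_zero_iff inner_ge_zero order_antisym)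
    have "(Zs *v (G *v y)) \<bullet> e i = 0" for y
      using matrix_inner_transpose[of "Zs ** G" y "e i"] z by (simp add: matrix_vector_mul_assoc)
    then have "span_proj {e i} ** Zs ** G = 0"
      by (simp add: matrix_eq span_proj_mult inner_commute flip: matrix_vector_mul_assoc)
    then have "span_proj {e i} ** Zs = 0" by (rule G_cancel)
    then have "span_proj {e i} *v (Zs *v x) = 0" by (simp add: matrix_vector_mul_assoc)
    then show ?thesis using basis_unit[OF i(1)] by (auto simp: span_proj_mult inner_commute)
  qed
  \<comment> \<open>The remaining basis vectors span a space of dimension \<open>s - 1\<close>.\<close>
  have "range ((*v) Zs) \<subseteq> span (e ` {1..s - 1})"
  proof
    fix y assume "y \<in> range ((*v) Zs)"
    then obtain x where y: "y = Zs *v x" by auto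
    have "y = (\<Sum>i\<in>{1..CARD('n)}. (y \<bullet> e i) *\<^sub>R e i)" by (simp only: basis_expand)
    also have "\<dots> = (\<Sum>i\<in>{1..s - 1}. (y \<bullet> e i) *\<^sub>R e i)"
      using s by (intro sum.mono_neutral_right) (auto simp: y orth)
    also have "\<dots> \<in> span (e ` {1..s - 1})"
      by (intro span_sum span_scale span_base) auto
    finally show "y \<in> span (e ` {1..s - 1})" .
  qed
  then have "rank Zs \<le> card (e ` {1..s - 1})"
    unfolding rank_dim_range by (rule dim_le_card) simp
  also have "\<dots> \<le> s - 1" using card_image_le[of "{1..s - 1}" e] by simp
  finally show False using s by simp
qed

end

section \<open>The regularised problem\<close>

lemma frobenius_norm_eq_norm: "frobenius_norm X = norm X"
  by (simp add: frobenius_norm_def norm_eq_sqrt_inner inner_vec_def power2_eq_square)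

lemma mult_hconcat: "X ** hconcat Y Z = hconcat (X ** Y) (X ** Z)"
  by (simp add: hconcat_def matrix_matrix_mult_def vec_eq_iff split: sum.split)

lemma hconcat_mult_transpose:
  "hconcat X Y ** transpose (hconcat X' Y') = X ** transpose X' + Y ** transpose Y'"
  by (simp add: hconcat_def matrix_matrix_mult_def transpose_def vec_eq_iff sum.Plus
      flip: UNIV_Plus_UNIV)

lemma hconcat_eq_0_iff: "hconcat X Y = 0 \<longleftrightarrow> X = 0 \<and> Y = 0"
proof
  assume zero: "hconcat X Y = 0"
  have "X $ i $ a = hconcat X Y $ i $ Inl a" "Y $ i $ b = hconcat X Y $ i $ Inr b" for i a b
    by (simp_all add: hconcat_def)
  with zero show "X = 0 \<and> Y = 0" by (simp add: vec_eq_iff)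
qed (simp add: hconcat_def vec_eq_iff split: sum.split)

lemma span_columns_eq_range:
  fixes X :: "real^'n^'m"
  shows "span (columns X) = range ((*v) X)"
proof
  show "span (columns X) \<subseteq> range ((*v) X)"
    by (intro span_minimal linear_subspace_image matrix_vector_mul_linear subspace_UNIV)
      (auto simp: columns_image_basis)
  show "range ((*v) X) \<subseteq> span (columns X)"
    using matrix_vector_mult_in_columnspace by blast
qed

lemma gram_ridge_invertible:
  fixes B :: "real^'k^'m"
  assumes "\<eta> \<noteq> 0"
  shows "invertible (B ** transpose B + \<eta>\<^sup>2 *\<^sub>R mat 1)"
proof -
  have "x = 0" if x: "(B ** transpose B + \<eta>\<^sup>2 *\<^sub>R mat 1) *v x = 0" for x
  proof -
    have sc: "(\<eta>\<^sup>2 *\<^sub>R mat 1) *v x = \<eta>\<^sup>2 *\<^sub>R x"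
      by (metis matrix_vector_mul_lid scaleR_matrix_vector_assoc)
    have "(B *v (transpose B *v x)) \<bullet> x = (transpose B *v x) \<bullet> (transpose B *v x)"
      by (rule matrix_inner_transpose)
    then have "((B ** transpose B + \<eta>\<^sup>2 *\<^sub>R mat 1) *v x) \<bullet> x
        = (transpose B *v x) \<bullet> (transpose B *v x) + \<eta>\<^sup>2 * (x \<bullet> x)"
      unfolding matrix_vector_mult_add_rdistrib sc inner_add_left matrix_vector_mul_assoc by simp
    then have "(transpose B *v x) \<bullet> (transpose B *v x) + \<eta>\<^sup>2 * (x \<bullet> x) = 0" using x by simp
    moreover have "0 \<le> (transpose B *v x) \<bullet> (transpose B *v x)" "0 \<le> \<eta>\<^sup>2 * (x \<bullet> x)" by auto
    ultimately have "\<eta>\<^sup>2 * (x \<bullet> x) = 0" by linarith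
    then show ?thesis using assms by simp
  qed
  then show ?thesis
    unfolding invertible_left_inverse matrix_left_invertible_ker by blast
qed

theorem mainTheorem2:
  fixes A :: "real^'n^'m" and M :: "real^'p^'n" and P :: "real^'m^'n"
    and F :: "real^'m^'n" and H :: "real^'n^'n"
    and Zr Zrl Zt :: "real^'m^'n"
    and \<eta> :: real and lam :: "nat \<Rightarrow> real" and k r l :: nat
  assumes "rank A = k" and "k \<le> CARD('n)" and "CARD('n) \<le> CARD('m)"
    and "rank M = CARD('n)" and "CARD('n) \<le> CARD('p)"
    and "0 < r" and "0 < l" and "r + l \<le> k"
    and "0 \<le> \<eta>" and "r < CARD('m) \<longrightarrow> \<eta> \<noteq> 0"
    and "F = (mat 1 - P ** A) ** M ** transpose M ** transpose A - \<eta>\<^sup>2 *\<^sub>R P"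
    and "r + l \<le> rank F"
    and "H = F ** matrix_inv (A ** M ** transpose M ** transpose A + \<eta>\<^sup>2 *\<^sub>R mat 1) ** transpose F"
    and "ordered_eigenvalues H lam" and "lam (CARD('n) + 1) = 0"
    and "global_minimizer A M P \<eta> r Zr"
    and "global_minimizer A M P \<eta> (r + l) Zrl"
    and "compatible_truncations lam r l Zr Zrl"
    and "Zt = Zrl - Zr"
  shows "rank Zt \<le> l \<and>
    update_minimizer A M P \<eta> Zr l Zt \<and>
    ((\<forall>Z. update_minimizer A M P \<eta> Zr l Z \<longrightarrow> Z = Zt) \<longleftrightarrow> lam (r + l) > lam (r + l + 1)) \<and>
    ((\<forall>Zr' Z. global_minimizer A M P \<eta> r Zr' \<and> update_minimizer A M P \<eta> Zr' l Z \<longrightarrow> Z = Zt)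
       \<longleftrightarrow> lam r > lam (r + 1) \<and> lam (r + l) > lam (r + l + 1))"
proof -
  define G where "G = hconcat (A ** M) (\<eta> *\<^sub>R mat 1 :: real^'m^'m)"
  define B where "B = hconcat (M - P ** A ** M) (- (\<eta> *\<^sub>R P))"
  define S where "S = A ** M ** transpose M ** transpose A + \<eta>\<^sup>2 *\<^sub>R (mat 1 :: real^'m^'m)"
  define Zs where "Zs = F ** matrix_inv S"
  have rlm: "r + l \<le> CARD('n)" using assms by simp
  have \<eta>: "\<eta> \<noteq> 0" using assms by simp
  have Gram: "G ** transpose G = S"
    by (simp add: G_def S_def hconcat_mult_transpose matrix_transpose_mul transpose_scalar
        matrix_mul_assoc matrix_scalar_ac power2_eq_square scalar_matrix_assoc)
  have BG: "B ** transpose G = F"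
    unfolding B_def G_def hconcat_mult_transpose assms(11)
    by (simp add: matrix_transpose_mul transpose_scalar matrix_mul_assoc matrix_scalar_ac
        matrix_mult_diff_left power2_eq_square vec_eq_iff)
  have "invertible S"
    using gram_ridge_invertible[OF \<eta>, of "A ** M"]
    by (simp add: S_def matrix_transpose_mul matrix_mul_assoc)
  then have inv: "matrix_inv S ** S = mat 1"
    unfolding invertible_def matrix_inv_def by (metis (mono_tags, lifting) someI_ex)
  \<comment> \<open>The normal equation: \<open>Zs\<close> is the minimiser of the objective without rank constraint.\<close>
  have ZS: "Zs ** S = F"
    by (simp add: Zs_def inv flip: matrix_mul_assoc)
  have H_eq: "H = (Zs ** G) ** transpose (Zs ** G)"
  proof -
    have "transpose S = S" by (simp add: Gram[symmetric] matrix_transpose_mul)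
    then have "transpose F = S ** transpose Zs"
      by (simp add: ZS[symmetric] matrix_transpose_mul)
    moreover have "H = Zs ** transpose F"
      using assms(13) by (simp add: Zs_def S_def)
    ultimately show ?thesis
      by (simp add: Gram[symmetric] matrix_transpose_mul matrix_mul_assoc)
  qed
  have symH: "transpose H = H" by (simp add: H_eq matrix_transpose_mul)
  obtain e where "ordered_eigenbasis H lam e"
    using ordered_eigenbasis_exists[OF symH assms(14)] .
  then interpret ordered_eigenbasis H lam e .
  interpret low_rank_problem H lam e Zs G
  proof
    show "X = 0" if "X ** G = 0" for X :: "real^'m^'n"
      using that \<eta> by (simp add: G_def mult_hconcat hconcat_eq_0_iff matrix_scalar_ac)
  qed (rule H_eq)
  \<comment> \<open>The residual of \<open>Zs\<close> is orthogonal to all multiples of \<open>G\<close>.\<close>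
  have obj: "inv_objective A M P \<eta> Z = err Z + (norm (Zs ** G - B))\<^sup>2" for Z
  proof -
    have "((Z - Zs) ** G) \<bullet> (Zs ** G - B) = (Z - Zs) \<bullet> ((Zs ** G - B) ** transpose G)"
      by (rule matrix_inner_mult_right)
    also have "(Zs ** G - B) ** transpose G = 0"
      by (simp add: matrix_mult_diff_left Gram BG ZS flip: matrix_mul_assoc)
    finally have "((Z - Zs) ** G) \<bullet> (Zs ** G - B) = 0" by simp
    moreover have "Z ** G - B = (Z - Zs) ** G + (Zs ** G - B)"
      by (simp add: matrix_mult_diff_left)
    ultimately have "(norm (Z ** G - B))\<^sup>2 = err Z + (norm (Zs ** G - B))\<^sup>2"
      using norm_add_Pythagorean[of "(Z - Zs) ** G" "Zs ** G - B"]
      by (simp only: err_def orthogonal_def)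
    then show ?thesis
      by (simp add: inv_objective_def frobenius_norm_eq_norm flip: G_def B_def)
  qed
  have glob: "global_minimizer A M P \<eta> s Z \<longleftrightarrow> best s Z" for s Z
    by (simp add: global_minimizer_def best_def is_arg_min_linorder obj)
  have upd: "update_minimizer A M P \<eta> Z0 l = is_arg_min (\<lambda>Z. err (Z0 + Z)) (\<lambda>Z. rank Z \<le> l)" for Z0
    by (simp add: fun_eq_iff update_minimizer_def is_arg_min_linorder obj)
  have "rank F \<le> rank Zs" using rank_mul_le_left[of Zs S] by (simp add: ZS)
  then have pos: "0 < lam (r + l)" using lam_pos[of "r + l"] assms rlm by simp
  have compat: "range ((*v) Zr) \<subseteq> range ((*v) Zrl)" if "lam r = lam (r + l + 1)"
    using assms(18) that by (simp add: compatible_truncations_def span_columns_eq_range)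
  \<comment> \<open>For \<open>s = n\<close> the convention \<open>lam (n + 1) = 0\<close> makes the gap automatic.\<close>
  have gaps: "(s < CARD('n) \<longrightarrow> lam (s + 1) < lam s) \<longleftrightarrow> lam (s + 1) < lam s"
    if "s = r \<or> s = r + l" for s
    using that pos assms(7,15) rlm by (cases "s < CARD('n)") auto
  show ?thesis
    using low_rank_update[OF assms(6,7) rlm pos assms(16,17)[unfolded glob] compat] gaps
    unfolding glob upd assms(19) by simp
qed

end
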